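(* Let $G$ be a locally compact second countable group. For every nonsingular $G$-space $(X,\mu)$, the following are equivalent: (1) $(X,\mu)$ is totally dissipative. (2) Modulo $\mu$, the orbit equivalence relation $E_G^X$ is smooth and all stabilizers are compact; that is, there is a $G$-invariant $\mu$-conull Borel set $X'\subseteq X$ such that $E_G^{X'}$ is smooth and the stabilizer of every $x\in X'$ is compact.
   Context: Fix a left Haar measure $\lambda$ on $G$. A Borel $G$-space is a standard Borel space $X$ with a Borel action map $G\times X\to X$, $(g,x)\mapsto g.x$. A nonsingular $G$-space is a Borel $G$-space $X$ with a $\sigma$-finite Borel measure $\mu$ such that $\mu\circ g\sim\mu$ for all $g\in G$, where $(\mu\circ g)(A)=\mu(g.A)$. Its Radon--Nikodym cocycle is a Borel map $\nabla:G\times X\to\mathbb{R}_{>0}$ satisfying $\nabla_e(x)=1$, $\nabla_{gh}(x)=\nabla_g(h.x)\nabla_h(x)$ for all $g,h,x$, and $\nabla_g=\frac{d\mu\circ g}{d\mu}$ $\mu$-a.e. for each $g$. $L^1_+(X,\mu)$ is the class of everywhere strictly positive functions in $L^1(X,\mu)$, and $S_f^G(x)=\int_G\nabla_g(x)f(g.x)\,d\lambda(g)$. The Hopf decomposition is the essentially unique decomposition $X=\mathcal{C}\sqcup\mathcal{D}$ into $G$-invariant Borel sets such that for every $f\in L^1_+(X,\mu)$, modulo $\mu$, $\mathcal{C}=\{S_f^G=+\infty\}$ and $\mathcal{D}=\{S_f^G<+\infty\}$. $(X,\mu)$ is totally dissipative if $\mu(\mathcal{C})=0$. $E_G^X=\{(x,g.x):x\in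 X,g\in G\}$; it is smooth if it admits a Borel transversal, i.e. a Borel set $W\subseteq X$ meeting every $G$-orbit in exactly one point. The stabilizer of $x$ is $G_x=\{g\in G:g.x=x\}$. *)

theory Defs
  imports "HOL-Analysis.Analysis"
begin

text \<open>
  Groups are written additively, following the class \<^class>\<open>topological_group_add\<close>: there is no
  multiplicative counterpart of it, and the underlying class \<^class>\<open>group_add\<close> does not assume
  commutativity. So \<open>0\<close> is the identity, \<open>g + h\<close> the product $gh$ and \<open>- g\<close> the inverse.
\<close>

text \<open>
  On a locally compact second countable Hausdorff group, a Borel measure that is finite on compact
  sets is automatically regular, so no regularity condition is needed.
\<close>

definition left_haar_measure :: "'g::topological_group_add measure \<Rightarrow> bool" where
  "left_haar_measure L \<longleftrightarrow>
     sets L = sets borel \<and>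
     (\<forall>g. \<forall>A\<in>sets borel. emeasure L ((\<lambda>h. g + h) ` A) = emeasure L A) \<and>
     (\<forall>K. compact K \<longrightarrow> emeasure L K < \<infinity>) \<and>
     emeasure L UNIV \<noteq> 0"

definition standard_borel_space :: "'x measure \<Rightarrow> bool" where
  "standard_borel_space M \<longleftrightarrow>
     (\<exists>T. completely_metrizable_space T \<and> second_countable T \<and> topspace T = space M \<and>
          sets M = sigma_sets (space M) {U. openin T U})"

text \<open>
  The underlying set of the space is \<^term>\<open>space M\<close>; values of the action outside of it are irrelevant.
  The measure carried by \<open>M\<close> plays no role in the next definition, only its \<open>\<sigma>\<close>-algebra does.
\<close>

definition borel_G_space ::
    "('g::topological_group_add \<Rightarrow> 'x \<Rightarrow> 'x) \<Rightarrow> 'x measure \<Rightarrow> bool" where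
  "borel_G_space act M \<longleftrightarrow>
     standard_borel_space M \<and>
     (\<lambda>(g, x). act g x) \<in> borel \<Otimes>\<^sub>M M \<rightarrow>\<^sub>M M \<and>
     (\<forall>x\<in>space M. act 0 x = x) \<and>
     (\<forall>g h. \<forall>x\<in>space M. act (g + h) x = act g (act h x))"

text \<open>
  The measure $\mu \circ g$, i.e. $A \mapsto \mu(g.A)$: the set $g.A$ is the preimage of $A$ under
  the action of the inverse of $g$ (see the lemma \<open>emeasure_translate_measure\<close> below).
\<close>

definition translate_measure ::
    "('g::topological_group_add \<Rightarrow> 'x \<Rightarrow> 'x) \<Rightarrow> 'x measure \<Rightarrow> 'g \<Rightarrow> 'x measure" where
  "translate_measure act M g = distr M M (act (- g))"

lemma emeasure_translate_measure:
  assumes "borel_G_space act M" and A: "A \<in> sets M"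
  shows "emeasure (translate_measure act M g) A = emeasure M (act g ` A)"
proof -
  have meas: "(\<lambda>(g, x). act g x) \<in> borel \<Otimes>\<^sub>M M \<rightarrow>\<^sub>M M"
    and id: "\<And>x. x \<in> space M \<Longrightarrow> act 0 x = x"
    and comp: "\<And>g h x. x \<in> space M \<Longrightarrow> act (g + h) x = act g (act h x)"
    using assms(1) by (auto simp: borel_G_space_def)
  have act: "act h \<in> M \<rightarrow>\<^sub>M M" for h
    using measurable_compose[OF measurable_Pair1'[of h borel M] meas] by simp
  have inv: "act (- g) (act g x) = x" "act g (act (- g) x) = x" if "x \<in> space M" for x
    using that by (simp_all add: comp[symmetric] id)
  have sp: "act h x \<in> space M" if "x \<in> space M" for h x
    using act that by (rule measurable_space)
  have AM: "A \<subseteq> space M"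
    using A by (rule sets.sets_into_space)
  have "act (- g) -` A \<inter> space M = act g ` A"
  proof (intro equalityI subsetI)
    fix x assume "x \<in> act (- g) -` A \<inter> space M"
    then show "x \<in> act g ` A" by (intro image_eqI[of _ _ "act (- g) x"]) (auto simp: inv)
  qed (use AM sp inv in auto)
  then show ?thesis
    by (simp add: translate_measure_def emeasure_distr[OF act A])
qed

definition nonsingular_G_space ::
    "('g::topological_group_add \<Rightarrow> 'x \<Rightarrow> 'x) \<Rightarrow> 'x measure \<Rightarrow> bool" where
  "nonsingular_G_space act M \<longleftrightarrow>
     borel_G_space act M \<and>
     sigma_finite_measure M \<and>
     (\<forall>g. absolutely_continuous M (translate_measure act M g) \<and>
          absolutely_continuous (translate_measure act M g) M)"

definition radon_nikodym_cocycle ::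
    "('g::topological_group_add \<Rightarrow> 'x \<Rightarrow> 'x) \<Rightarrow> 'x measure \<Rightarrow> ('g \<Rightarrow> 'x \<Rightarrow> real) \<Rightarrow> bool" where
  "radon_nikodym_cocycle act M rn \<longleftrightarrow>
     (\<lambda>(g, x). rn g x) \<in> borel_measurable (borel \<Otimes>\<^sub>M M) \<and>
     (\<forall>g. \<forall>x\<in>space M. rn g x > 0) \<and>
     (\<forall>x\<in>space M. rn 0 x = 1) \<and>
     (\<forall>g h. \<forall>x\<in>space M. rn (g + h) x = rn g (act h x) * rn h x) \<and>
     (\<forall>g. AE x in M. ennreal (rn g x) = RN_deriv M (translate_measure act M g) x)"

definition L1_plus :: "'x measure \<Rightarrow> ('x \<Rightarrow> real) set" where
  "L1_plus M = {f. integrable M f \<and> (\<forall>x\<in>space M. f x > 0)}"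

definition orbit_integral ::
    "'g measure \<Rightarrow> ('g \<Rightarrow> 'x \<Rightarrow> 'x) \<Rightarrow> ('g \<Rightarrow> 'x \<Rightarrow> real) \<Rightarrow> ('x \<Rightarrow> real) \<Rightarrow> 'x \<Rightarrow> ennreal" where
  "orbit_integral L act rn f x = (\<integral>\<^sup>+ g. ennreal (rn g x * f (act g x)) \<partial>L)"

definition G_invariant :: "('g \<Rightarrow> 'x \<Rightarrow> 'x) \<Rightarrow> 'x set \<Rightarrow> bool" where
  "G_invariant act A \<longleftrightarrow> (\<forall>g. act g ` A = A)"

definition hopf_decomposition ::
    "'g measure \<Rightarrow> ('g \<Rightarrow> 'x \<Rightarrow> 'x) \<Rightarrow> 'x measure \<Rightarrow> ('g \<Rightarrow> 'x \<Rightarrow> real) \<Rightarrow>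
     'x set \<Rightarrow> 'x set \<Rightarrow> bool" where
  "hopf_decomposition L act M rn C D \<longleftrightarrow>
     C \<in> sets M \<and> D \<in> sets M \<and>
     C \<inter> D = {} \<and> C \<union> D = space M \<and>
     G_invariant act C \<and> G_invariant act D \<and>
     (\<forall>f\<in>L1_plus M.
        (AE x in M. x \<in> C \<longleftrightarrow> orbit_integral L act rn f x = \<infinity>) \<and>
        (AE x in M. x \<in> D \<longleftrightarrow> orbit_integral L act rn f x < \<infinity>))"

text \<open>
  The Hopf decomposition is unique up to null sets, since \<^term>\<open>L1_plus M\<close> is nonempty for a
  \<open>\<sigma>\<close>-finite \<open>M\<close>; hence the condition below does not depend on which decomposition is picked.
\<close>

definition totally_dissipative ::
    "'g measure \<Rightarrow> ('g \<Rightarrow> 'x \<Rightarrow> 'x) \<Rightarrow> 'x measure \<Rightarrow> ('g \<Rightarrow> 'x \<Rightarrow> real) \<Rightarrow> bool" where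
  "totally_dissipative L act M rn \<longleftrightarrow>
     (\<exists>C D. hopf_decomposition L act M rn C D \<and> emeasure M C = 0)"

definition orbit_equivalence_relation :: "('g \<Rightarrow> 'x \<Rightarrow> 'x) \<Rightarrow> 'x set \<Rightarrow> ('x \<times> 'x) set" where
  "orbit_equivalence_relation act X = {(x, act g x) | x g. x \<in> X}"

definition smooth_relation :: "'x measure \<Rightarrow> ('x \<times> 'x) set \<Rightarrow> bool" where
  "smooth_relation N E \<longleftrightarrow> (\<exists>W\<in>sets N. \<forall>x\<in>space N. \<exists>!w. w \<in> W \<inter> E `` {x})"

definition stabilizer :: "('g \<Rightarrow> 'x \<Rightarrow> 'x) \<Rightarrow> 'x \<Rightarrow> 'g set" where
  "stabilizer act x = {g. act g x = x}"

end

theory Submission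
  imports Defs
begin

text \<open>
  Write $S_f$ for the orbit integral of $f$, $\nabla$ for the cocycle and $\lambda$ for the Haar measure.

  A smooth action with compact stabilizers is dissipative because of the mass transport identity
  $\int S_f H\,d\mu = \int f\,\theta_H\,d\mu$ with $\theta_H(x) = \int_G H(g^{-1}.x)\,d\lambda(g)$
  (lemma \<open>mass_transport\<close>): wherever $H > 0$, the function $S_f$ is finite almost everywhere as soon as
  $\theta_H$ is bounded. Take for $H$ the indicator of a subset of $K.W$, where $W$ is a transversal and
  $K$ is compact. For $x = h.w$ with $w \in W$ the number $\theta_H(x)$ is at most
  $\lambda(h\,G_w K^{-1})$, which is finite because $G_w$ is compact. Left invariance of $\lambda$
  makes $\theta_H$ a $G$-invariant function, so that cutting $H$ off at the level sets of $\theta_H$ achieves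
  boundedness (lemma \<open>orbit_integral_finite_on\<close>). Finally $K.W$ is the projection of a Borel set along
  $K$. It need not be Borel, but it contains Borel sets of almost its full outer measure (lemma
  \<open>measurable_projection\<close>), and the sets $K.W$ exhaust the space as $K$ grows to $G$.

  Conversely, let $f$ be in $L^1_+$ and let $X' = \{S_f < \infty\}$, a conull set. It is invariant,
  since right translation multiplies $\lambda$ by a constant; this is the uniqueness of Haar measure.
  For $x \in X'$ the probability measure $dp_x(g) = \nabla_g(x) f(g.x)\,d\lambda(g) / S_f(x)$ satisfies the
  equivariance $\int \psi(g)\,dp_{h.x}(g) = \int \psi(g h^{-1})\,dp_x(g)$, and so does its restriction to
  $\{g : g.x \in U\}$ for every Borel set $U$ (lemma \<open>orbit_measure_translate\<close>). Integrating countably many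
  compactly supported continuous functions against these restrictions, with $U$ running through countably
  many sets that separate points, gives coordinates $\Phi_j(x)$ that determine $x$. Along an orbit,
  $h \mapsto \Phi_j(h.x)$ is continuous and vanishes at infinity, although the action itself is only Borel.
  The stabilizer is the set where all these functions take their values at the identity. Hence it is closed, and
  as one of the values is positive, it is compact. Moreover every orbit in $X'$ contains a point whose coordinate sequence is lexicographically greatest, this
  point is unique because the coordinates determine it, and the points obtained in this way form a
  Borel transversal (lemma \<open>dissipative_part_smooth\<close>).
\<close>

section \<open>Projections of Borel sets along a compact set\<close>

text \<open>
  The closed subsets of the Baire space of sequences of natural numbers.
\<close>

definition baire_closed :: "(nat \<Rightarrow> nat) set \<Rightarrow> bool" where
  "baire_closed F \<longleftrightarrow> (\<forall>\<sigma>. (\<forall>n. \<exists>\<tau>\<in>F. \<forall>i<n. \<tau> i = \<sigma> i) \<longrightarrow> \<sigma> \<in> F)"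

lemma baire_closedD:
  assumes "baire_closed F" "\<And>n. \<exists>\<tau>\<in>F. \<forall>i<n. \<tau> i = \<sigma> i"
  shows "\<sigma> \<in> F"
  using assms(1)[unfolded baire_closed_def, rule_format, of \<sigma>] assms(2) by simp

text \<open>
  An analytic set over the rectangles with closed first and measurable second side. The usual Souslin
  operation indexes its sets by finite sequences. Here the $i$-th set depends on the $i$-th entry
  of $\sigma$ only, and the closed set $F$ of admissible sequences carries the remaining dependence.
  In this form countable unions and intersections amount to recoding sequences.
\<close>

definition souslin_scheme :: "'x measure \<Rightarrow> (nat \<Rightarrow> nat) set \<Rightarrow> (nat \<Rightarrow> nat \<Rightarrow> 'g::topological_space set) \<Rightarrow>
    (nat \<Rightarrow> nat \<Rightarrow> 'x set) \<Rightarrow> ('g \<times> 'x) set \<Rightarrow> bool" where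
  "souslin_scheme N F Q P B \<longleftrightarrow> baire_closed F \<and> (\<forall>i m. closed (Q i m) \<and> P i m \<in> sets N) \<and>
     B = {(g, x). \<exists>\<sigma>\<in>F. \<forall>i. g \<in> Q i (\<sigma> i) \<and> x \<in> P i (\<sigma> i)}"

definition souslin :: "'x measure \<Rightarrow> ('g::topological_space \<times> 'x) set \<Rightarrow> bool" where
  "souslin N B \<longleftrightarrow> (\<exists>F Q P. souslin_scheme N F Q P B)"

lemma souslin_rectangle:
  assumes "closed Q" "P \<in> sets N"
  shows "souslin N (Q \<times> P)"
  unfolding souslin_def souslin_scheme_def baire_closed_def using assms
  by (intro exI[of _ UNIV] exI[of _ "\<lambda>i m. Q"] exI[of _ "\<lambda>i m. P"]) auto

text \<open>
  Every entry of the recoded sequence carries the index of the member of the union. That all entries agree on it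
  is a closed condition.
\<close>

lemma souslin_UN:
  assumes "\<And>k::nat. souslin N (B k)"
  shows "souslin N (\<Union>k. B k)"
proof -
  have "\<forall>k. \<exists>F Q P. souslin_scheme N F Q P (B k)" using assms by (simp add: souslin_def)
  then obtain F Q P where sch: "\<And>k. souslin_scheme N (F k) (Q k) (P k) (B k)" by metis
  then have F: "\<And>k. baire_closed (F k)"
    and Q: "\<And>k i m. closed (Q k i m)" and P: "\<And>k i m. P k i m \<in> sets N"
    and B: "\<And>k. B k = {(g, x). \<exists>\<sigma>\<in>F k. \<forall>i::nat. g \<in> Q k i (\<sigma> i) \<and> x \<in> P k i (\<sigma> i)}"
    using sch unfolding souslin_scheme_def by blast+
  define F' where "F' = {\<sigma>. \<exists>k. (\<forall>n. fst (prod_decode (\<sigma> n)) = k) \<and> (\<lambda>n. snd (prod_decode (\<sigma> n))) \<in> F k}"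
  define Q' where "Q' i m = Q (fst (prod_decode m)) i (snd (prod_decode m))" for i m
  define P' where "P' i m = P (fst (prod_decode m)) i (snd (prod_decode m))" for i m
  have "baire_closed F'"
    unfolding baire_closed_def
  proof (intro allI impI)
    fix \<sigma> assume *: "\<forall>n. \<exists>\<tau>\<in>F'. \<forall>i<n. \<tau> i = \<sigma> i"
    define k where "k = fst (prod_decode (\<sigma> 0))"
    have approx: "\<exists>\<tau>. (\<forall>n. fst (prod_decode (\<tau> n)) = k) \<and> (\<lambda>n. snd (prod_decode (\<tau> n))) \<in> F k \<and> (\<forall>i<n. \<tau> i = \<sigma> i)" for n
    proof -
      obtain \<tau> where \<tau>: "\<tau> \<in> F'" "\<forall>i<Suc n. \<tau> i = \<sigma> i" using * by blast
      then have "fst (prod_decode (\<tau> 0)) = k" by (simp add: k_def)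
      moreover obtain k' where k': "\<forall>n. fst (prod_decode (\<tau> n)) = k'" "(\<lambda>n. snd (prod_decode (\<tau> n))) \<in> F k'"
        using \<tau>(1) unfolding F'_def by blast
      ultimately have "k' = k" by metis
      then show ?thesis using \<tau>(2) k' by (intro exI[of _ \<tau>]) auto
    qed
    have "fst (prod_decode (\<sigma> n)) = k" for n
      using approx[of "Suc n"] by (metis lessI)
    moreover have "(\<lambda>n. snd (prod_decode (\<sigma> n))) \<in> F k"
    proof -
      have "\<exists>\<tau>\<in>F k. \<forall>i<n. \<tau> i = snd (prod_decode (\<sigma> i))" for n
        using approx[of n] by (metis (no_types, lifting))
      then show ?thesis by (rule baire_closedD[OF F])
    qed
    ultimately show "\<sigma> \<in> F'" unfolding F'_def by blast
  qed
  moreover have "(\<Union>k. B k) = {(g, x). \<exists>\<sigma>\<in>F'. \<forall>i. g \<in> Q' i (\<sigma> i) \<and> x \<in> P' i (\<sigma> i)}"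
  proof (intro set_eqI iffI; clarify)
    fix g x k assume "(g, x) \<in> B k"
    then obtain \<sigma> where s: "\<sigma> \<in> F k" "\<forall>i. g \<in> Q k i (\<sigma> i) \<and> x \<in> P k i (\<sigma> i)" by (auto simp: B)
    then show "\<exists>\<sigma>\<in>F'. \<forall>i. g \<in> Q' i (\<sigma> i) \<and> x \<in> P' i (\<sigma> i)"
      by (intro bexI[of _ "\<lambda>n. prod_encode (k, \<sigma> n)"]) (auto simp: F'_def Q'_def P'_def)
  next
    fix g x \<sigma> assume s: "\<sigma> \<in> F'" "\<forall>i. g \<in> Q' i (\<sigma> i) \<and> x \<in> P' i (\<sigma> i)"
    then obtain k where "\<forall>n. fst (prod_decode (\<sigma> n)) = k" "(\<lambda>n. snd (prod_decode (\<sigma> n))) \<in> F k"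
      by (auto simp: F'_def)
    with s have "(g, x) \<in> B k" by (auto simp: B Q'_def P'_def)
    then show "(g, x) \<in> (\<Union>k. B k)" by blast
  qed
  ultimately show ?thesis
    unfolding souslin_def souslin_scheme_def using Q P
    by (intro exI[of _ F'] exI[of _ Q'] exI[of _ P']) (auto simp: Q'_def P'_def)
qed

text \<open>
  One sequence encodes countably many through a pairing function.
\<close>

lemma souslin_INT:
  assumes "\<And>k::nat. souslin N (B k)"
  shows "souslin N (\<Inter>k. B k)"
proof -
  have "\<forall>k. \<exists>F Q P. souslin_scheme N F Q P (B k)" using assms by (simp add: souslin_def)
  then obtain F Q P where sch: "\<And>k. souslin_scheme N (F k) (Q k) (P k) (B k)" by metis
  then have F: "\<And>k. baire_closed (F k)"
    and Q: "\<And>k i m. closed (Q k i m)" and P: "\<And>k i m. P k i m \<in> sets N"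
    and B: "\<And>k. B k = {(g, x). \<exists>\<sigma>\<in>F k. \<forall>i::nat. g \<in> Q k i (\<sigma> i) \<and> x \<in> P k i (\<sigma> i)}"
    using sch unfolding souslin_scheme_def by blast+
  define F' where "F' = {\<sigma>. \<forall>k. (\<lambda>i. \<sigma> (prod_encode (k, i))) \<in> F k}"
  define Q' where "Q' n = Q (fst (prod_decode n)) (snd (prod_decode n))" for n
  define P' where "P' n = P (fst (prod_decode n)) (snd (prod_decode n))" for n
  have "baire_closed F'"
    unfolding baire_closed_def
  proof (intro allI impI)
    fix \<sigma> assume *: "\<forall>n. \<exists>\<tau>\<in>F'. \<forall>i<n. \<tau> i = \<sigma> i"
    have "(\<lambda>i. \<sigma> (prod_encode (k, i))) \<in> F k" for k
    proof -
      have "\<exists>\<tau>\<in>F k. \<forall>i<n. \<tau> i = \<sigma> (prod_encode (k, i))" for n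
      proof -
        obtain \<tau> where \<tau>: "\<tau> \<in> F'" "\<forall>i<Suc (Max ((\<lambda>i. prod_encode (k, i)) ` {..<n})). \<tau> i = \<sigma> i"
          using * by blast
        have "\<tau> (prod_encode (k, i)) = \<sigma> (prod_encode (k, i))" if "i < n" for i
          using \<tau>(2) that by (auto simp: less_Suc_eq_le intro!: Max_ge)
        with \<tau>(1) show ?thesis
          unfolding F'_def by (intro bexI[of _ "\<lambda>i. \<tau> (prod_encode (k, i))"]) auto
      qed
      then show ?thesis by (rule baire_closedD[OF F])
    qed
    then show "\<sigma> \<in> F'" unfolding F'_def by blast
  qed
  moreover have "(\<Inter>k. B k) = {(g, x). \<exists>\<sigma>\<in>F'. \<forall>i. g \<in> Q' i (\<sigma> i) \<and> x \<in> P' i (\<sigma> i)}"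
  proof (intro set_eqI iffI; clarify)
    fix g x assume "(g, x) \<in> (\<Inter>k. B k)"
    then have "\<forall>k. \<exists>\<sigma>\<in>F k. \<forall>i. g \<in> Q k i (\<sigma> i) \<and> x \<in> P k i (\<sigma> i)" by (auto simp: B)
    then obtain s where s: "\<And>k. s k \<in> F k" "\<And>k i. g \<in> Q k i (s k i) \<and> x \<in> P k i (s k i)" by metis
    define \<sigma> where "\<sigma> = (\<lambda>n. s (fst (prod_decode n)) (snd (prod_decode n)))"
    have "\<sigma> \<in> F'" using s(1) by (auto simp: F'_def \<sigma>_def)
    then show "\<exists>\<sigma>\<in>F'. \<forall>i. g \<in> Q' i (\<sigma> i) \<and> x \<in> P' i (\<sigma> i)"
      using s(2) by (intro bexI[of _ \<sigma>]) (auto simp: \<sigma>_def Q'_def P'_def)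
  next
    fix g x \<sigma> k assume s: "\<sigma> \<in> F'" "\<forall>i. g \<in> Q' i (\<sigma> i) \<and> x \<in> P' i (\<sigma> i)"
    show "(g, x) \<in> B k"
      unfolding B mem_Collect_eq prod.case
    proof (intro bexI[of _ "\<lambda>i. \<sigma> (prod_encode (k, i))"] allI)
      show "(\<lambda>i. \<sigma> (prod_encode (k, i))) \<in> F k" using s(1) by (auto simp: F'_def)
      show "g \<in> Q k i (\<sigma> (prod_encode (k, i))) \<and> x \<in> P k i (\<sigma> (prod_encode (k, i)))" for i
        using s(2)[rule_format, of "prod_encode (k, i)"] by (simp add: Q'_def P'_def)
    qed
  qed
  ultimately show ?thesis
    unfolding souslin_def souslin_scheme_def using Q P
    by (intro exI[of _ F'] exI[of _ Q'] exI[of _ P']) (auto simp: Q'_def P'_def)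
qed

lemma souslin_Un:
  assumes "souslin N A" "souslin N B"
  shows "souslin N (A \<union> B)"
proof -
  have "A \<union> B = (\<Union>k::nat. if k = 0 then A else B)" by (auto split: if_splits intro: exI[of _ 1])
  moreover have "souslin N (\<Union>k::nat. if k = 0 then A else B)" using assms by (intro souslin_UN) simp
  ultimately show ?thesis by metis
qed

lemma souslin_Int:
  assumes "souslin N A" "souslin N B"
  shows "souslin N (A \<inter> B)"
proof -
  have "A \<inter> B = (\<Inter>k::nat. if k = 0 then A else B)" by (auto split: if_splits dest: spec[of _ 1])
  moreover have "souslin N (\<Inter>k::nat. if k = 0 then A else B)" using assms by (intro souslin_INT) simp
  ultimately show ?thesis by metis
qed

text \<open>
  The analytic sets whose complement is analytic form a $\sigma$-algebra. It contains the open cylinders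
  because open sets are countable unions of closed ones.
\<close>

lemma souslin_product_measurable:
  fixes B :: "('g::topological_space \<times> 'x) set"
  assumes open_Fsigma: "\<And>U::'g set. open U \<Longrightarrow> \<exists>C::nat \<Rightarrow> 'g set. (\<forall>n. closed (C n)) \<and> U = (\<Union>n. C n)"
    and B: "B \<in> sets (borel \<Otimes>\<^sub>M N)"
  shows "souslin N B"
proof -
  let ?\<Omega> = "(UNIV :: 'g set) \<times> space N"
  let ?T = "\<lambda>B. B \<subseteq> ?\<Omega> \<and> souslin N B \<and> souslin N (?\<Omega> - B)"
  have T_compl: "?T (?\<Omega> - A)" if "?T A" for A
    using that by (auto simp: double_diff)
  have T_UN: "?T (\<Union>k::nat. A k)" if "\<And>k. ?T (A k)" for A
  proof (intro conjI)
    show "souslin N (\<Union>k. A k)" using that by (intro souslin_UN) auto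
    have "?\<Omega> - (\<Union>k. A k) = (\<Inter>k. ?\<Omega> - A k)" by auto
    then show "souslin N (?\<Omega> - (\<Union>k. A k))" using that souslin_INT[of N "\<lambda>k. ?\<Omega> - A k"] by auto
  qed (use that in blast)
  have empty: "souslin N ({} :: ('g \<times> 'x) set)"
    using souslin_rectangle[of "{}" "{}" N] by simp
  have full: "souslin N ?\<Omega>" by (intro souslin_rectangle) auto
  have T_open: "?T (U \<times> space N)" if U: "open U" for U
  proof (intro conjI)
    obtain C where C: "\<And>n. closed (C n)" "U = (\<Union>n::nat. C n)" using open_Fsigma[OF U] by blast
    have "U \<times> space N = (\<Union>n. C n \<times> space N)" using C by auto
    then show "souslin N (U \<times> space N)"
      using souslin_UN[of N "\<lambda>n. C n \<times> space N"] souslin_rectangle[OF C(1), of "space N" N] by simp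
    have "?\<Omega> - U \<times> space N = (- U) \<times> space N" by auto
    then show "souslin N (?\<Omega> - U \<times> space N)"
      using U souslin_rectangle[of "- U" "space N" N] by (simp add: closed_Compl)
  qed auto
  have T_borel: "?T (Q \<times> space N)" if "Q \<in> sets borel" for Q
  proof -
    have "Q \<in> sigma_sets UNIV {S. open S}" using that by (simp add: borel_def)
    then show ?thesis
    proof induction
      case (Basic a) then show ?case using T_open by auto
    next
      case Empty show ?case using empty full by simp
    next
      case (Compl a)
      have "(UNIV - a) \<times> space N = ?\<Omega> - a \<times> space N" by auto
      then show ?case using T_compl[OF Compl.IH] by simp
    next
      case (Union a)
      have "(\<Union> (range a)) \<times> space N = (\<Union>k. a k \<times> space N)" by auto
      then show ?case using T_UN[of "\<lambda>k. a k \<times> space N"] Union.IH by simp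
    qed
  qed
  have T_rect: "?T (Q \<times> P)" if "Q \<in> sets borel" "P \<in> sets N" for Q P
  proof (intro conjI)
    have P: "P \<subseteq> space N" using that(2) by (rule sets.sets_into_space)
    have "Q \<times> P = Q \<times> space N \<inter> UNIV \<times> P" using P by auto
    then show "souslin N (Q \<times> P)"
      using souslin_Int[of N "Q \<times> space N" "UNIV \<times> P"] T_borel[OF that(1)]
        souslin_rectangle[of UNIV P N] that(2) by simp
    have "?\<Omega> - Q \<times> P = (?\<Omega> - Q \<times> space N) \<union> UNIV \<times> (space N - P)" using P by auto
    then show "souslin N (?\<Omega> - Q \<times> P)"
      using souslin_Un[of N "?\<Omega> - Q \<times> space N" "UNIV \<times> (space N - P)"] T_borel[OF that(1)]
        souslin_rectangle[of UNIV "space N - P" N] that(2) by simp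
    show "Q \<times> P \<subseteq> ?\<Omega>" using P by auto
  qed
  have "B \<in> sigma_sets ?\<Omega> {Q \<times> P | Q P. Q \<in> sets borel \<and> P \<in> sets N}"
    using B by (simp add: sets_pair_measure)
  then have "?T B"
  proof induction
    case (Basic a) then show ?case using T_rect by blast
  next
    case Empty show ?case using empty full by simp
  next
    case (Compl a) then show ?case by (rule_tac T_compl)
  next
    case (Union a) then show ?case by (rule_tac T_UN)
  qed
  then show ?thesis by simp
qed

text \<open>
  Choquet's capacitability argument. Outer measure is continuous along increasing unions, so the entries of
  the sequences in a Souslin scheme can be bounded one after another, by $b_0, b_1, \dots$, without the
  outer measure of the projection dropping to $c$. Stopping after $n$ entries leaves a finite union of
  rectangles, whose projection $C_n$ is measurable and has measure above $c$. The bounded sequences together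
  with $K$ form a compact set, and therefore a point in all $C_n$ already lies in the
  projection of the original set.
\<close>

theorem measurable_projection:
  fixes B :: "('g::{second_countable_topology, t2_space} \<times> 'x) set"
  assumes open_Fsigma: "\<And>U::'g set. open U \<Longrightarrow> \<exists>C::nat \<Rightarrow> 'g set. (\<forall>n. closed (C n)) \<and> U = (\<Union>n. C n)"
    and B: "B \<in> sets (borel \<Otimes>\<^sub>M N)" and "finite_measure N" and K: "compact K"
    and c: "c < outer_measure_of N {x\<in>space N. \<exists>g\<in>K. (g, x) \<in> B}"
  shows "\<exists>C\<in>sets N. C \<subseteq> {x\<in>space N. \<exists>g\<in>K. (g, x) \<in> B} \<and> c \<le> emeasure N C"
proof -
  interpret finite_measure N by fact
  have "souslin N B"
    by (rule souslin_product_measurable[OF _ B]) (rule open_Fsigma)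
  then obtain F Q P where "souslin_scheme N F Q P B" unfolding souslin_def by blast
  then have F: "baire_closed F"
    and Q: "\<And>i m. closed (Q i m)" and P: "\<And>i m. P i m \<in> sets N"
    and Beq: "B = {(g, x). \<exists>\<sigma>\<in>F. \<forall>i. g \<in> Q i (\<sigma> i) \<and> x \<in> P i (\<sigma> i)}"
    unfolding souslin_scheme_def by blast+
  define T where "T \<Sigma> = {x\<in>space N. \<exists>g\<in>K. \<exists>\<sigma>\<in>\<Sigma>. \<forall>i. g \<in> Q i (\<sigma> i) \<and> x \<in> P i (\<sigma> i)}" for \<Sigma>
  have TF: "T F = {x\<in>space N. \<exists>g\<in>K. (g, x) \<in> B}" unfolding T_def Beq by auto
  have split: "\<exists>m. c < outer_measure_of N (T {\<sigma>\<in>\<Sigma>. \<sigma> n \<le> m})" if "c < outer_measure_of N (T \<Sigma>)" for \<Sigma> and n :: nat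
  proof -
    have "T \<Sigma> = (\<Union>m. T {\<sigma>\<in>\<Sigma>. \<sigma> n \<le> m})" unfolding T_def by auto
    moreover have "(SUP m. outer_measure_of N (T {\<sigma>\<in>\<Sigma>. \<sigma> n \<le> m})) = outer_measure_of N (\<Union>m. T {\<sigma>\<in>\<Sigma>. \<sigma> n \<le> m})"
      by (intro SUP_outer_measure_of_incseq incseq_SucI) (auto simp: T_def intro: le_SucI)
    ultimately have "c < (SUP m. outer_measure_of N (T {\<sigma>\<in>\<Sigma>. \<sigma> n \<le> m}))" using that by metis
    then show ?thesis by (simp add: less_SUP_iff)
  qed
  have "\<exists>S. \<forall>n. (c < outer_measure_of N (T (S n)) \<and> (n = 0 \<longrightarrow> S n = F)) \<and> (\<exists>m. S (Suc n) = {\<sigma>\<in>S n. \<sigma> n \<le> m})"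
    proof (rule dependent_nat_choice)
      show "\<exists>\<Sigma>. c < outer_measure_of N (T \<Sigma>) \<and> (0 = (0::nat) \<longrightarrow> \<Sigma> = F)" using c TF by auto
      show "\<exists>\<Sigma>'. (c < outer_measure_of N (T \<Sigma>') \<and> (Suc n = 0 \<longrightarrow> \<Sigma>' = F)) \<and> (\<exists>m. \<Sigma>' = {\<sigma>\<in>\<Sigma>. \<sigma> n \<le> m})"
        if "c < outer_measure_of N (T \<Sigma>) \<and> (n = 0 \<longrightarrow> \<Sigma> = F)" for \<Sigma> n
        using split[of \<Sigma> n] that by blast
    qed
  then obtain S where cS: "\<And>n. c < outer_measure_of N (T (S n))" and S0: "S 0 = F"
    and S': "\<forall>n. \<exists>m. S (Suc n) = {\<sigma>\<in>S n. \<sigma> n \<le> m}" by blast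
  obtain b where SSuc: "\<And>n. S (Suc n) = {\<sigma>\<in>S n. \<sigma> n \<le> b n}" using choice[OF S'] by blast
  have S: "S n = {\<sigma>\<in>F. \<forall>i<n. \<sigma> i \<le> b i}" for n
    by (induction n) (auto simp: S0 SSuc less_Suc_eq)
  define C where "C n = {x\<in>space N. \<exists>g\<in>K. \<exists>\<sigma>\<in>F. \<forall>i<n. \<sigma> i \<le> b i \<and> g \<in> Q i (\<sigma> i) \<and> x \<in> P i (\<sigma> i)}" for n
  have C_sets: "C n \<in> sets N" for n
  proof -
    let ?V = "{\<tau>. (\<exists>\<sigma>\<in>F. \<tau> = restrict \<sigma> {..<n}) \<and> (\<exists>g\<in>K. \<forall>i<n. g \<in> Q i (\<tau> i)) \<and> (\<forall>i<n. \<tau> i \<le> b i)}"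
    have "?V \<subseteq> (\<Pi>\<^sub>E i\<in>{..<n}. {..b i})" by (auto simp: PiE_def extensional_def split: if_splits)
    then have fin: "finite ?V" by (rule finite_subset) (intro finite_PiE, auto)
    have Cn: "C n = (\<Union>\<tau>\<in>?V. {x\<in>space N. \<forall>i<n. x \<in> P i (\<tau> i)})"
    proof (intro set_eqI iffI)
      fix x assume "x \<in> C n"
      then obtain g \<sigma> where *: "x \<in> space N" "g \<in> K" "\<sigma> \<in> F"
        "\<forall>i<n. \<sigma> i \<le> b i \<and> g \<in> Q i (\<sigma> i) \<and> x \<in> P i (\<sigma> i)" unfolding C_def by blast
      then show "x \<in> (\<Union>\<tau>\<in>?V. {x\<in>space N. \<forall>i<n. x \<in> P i (\<tau> i)})"
        by (intro UN_I[of "restrict \<sigma> {..<n}"]) auto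
    next
      fix x assume "x \<in> (\<Union>\<tau>\<in>?V. {x\<in>space N. \<forall>i<n. x \<in> P i (\<tau> i)})"
      then obtain g \<sigma> where *: "x \<in> space N" "g \<in> K" "\<sigma> \<in> F"
        "\<forall>i<n. \<sigma> i \<le> b i \<and> g \<in> Q i (\<sigma> i) \<and> x \<in> P i (\<sigma> i)" by auto
      then show "x \<in> C n" unfolding C_def by blast
    qed
    have "{x\<in>space N. \<forall>i<n. x \<in> P i (\<tau> i)} \<in> sets N" for \<tau>
      using P by measurable
    then show ?thesis unfolding Cn by (intro sets.finite_UN fin)
  qed
  have "decseq C"
    unfolding decseq_def
  proof (intro allI impI subsetI)
    fix m n x assume "m \<le> n" "x \<in> C n"
    then obtain g \<sigma> where *: "x \<in> space N" "g \<in> K" "\<sigma> \<in> F"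
        "\<forall>i<n. \<sigma> i \<le> b i \<and> g \<in> Q i (\<sigma> i) \<and> x \<in> P i (\<sigma> i)" unfolding C_def by blast
    with \<open>m \<le> n\<close> have "\<forall>i<m. \<sigma> i \<le> b i \<and> g \<in> Q i (\<sigma> i) \<and> x \<in> P i (\<sigma> i)" by auto
    with * show "x \<in> C m" unfolding C_def by blast
  qed
  have "c \<le> emeasure N (C n)" for n
  proof -
    have "T (S n) \<subseteq> C n" unfolding T_def S C_def by auto
    then have "outer_measure_of N (T (S n)) \<le> outer_measure_of N (C n)" by (rule outer_measure_of_mono)
    also have "\<dots> = emeasure N (C n)" by (rule outer_measure_of_eq[OF C_sets])
    finally show ?thesis using cS[of n] by auto
  qed
  moreover have "(INF n. emeasure N (C n)) = emeasure N (\<Inter>n. C n)"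
    using C_sets \<open>decseq C\<close> by (intro INF_emeasure_decseq) auto
  ultimately have "c \<le> emeasure N (\<Inter>n. C n)" by (metis INF_greatest)
  moreover have "(\<Inter>n. C n) \<subseteq> T F"
  proof
    fix x assume x: "x \<in> (\<Inter>n. C n)"
    then have xN: "x \<in> space N" by (auto simp: C_def)
    have "\<forall>n. \<exists>g \<sigma>. g\<in>K \<and> \<sigma>\<in>F \<and> (\<forall>i<n. \<sigma> i \<le> b i \<and> g \<in> Q i (\<sigma> i) \<and> x \<in> P i (\<sigma> i))"
      using x unfolding C_def by blast
    then obtain g s where g: "\<And>n. g n \<in> K" and s: "\<And>n. s n \<in> F"
      and gs: "\<And>n i. i < n \<Longrightarrow> s n i \<le> b i \<and> g n \<in> Q i (s n i) \<and> x \<in> P i (s n i)" by metis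
    (* Only the first n entries of s n are bounded. Truncating the others moves the sequences into a
       compact product and does not affect the pointwise limit. *)
    define t where "t n = (\<lambda>i. min (s n i) (b i))" for n
    have "compactin (product_topology (\<lambda>i::nat. euclidean::nat topology) UNIV) (\<Pi>\<^sub>E i\<in>UNIV. {..b i})"
      by (subst compactin_PiE) (auto intro: finite_imp_compact)
    then have cb: "compact (\<Pi>\<^sub>E i\<in>UNIV. {..b i})"
      by (simp add: euclidean_product_topology)
    then have sc: "seq_compact (K \<times> (\<Pi>\<^sub>E i\<in>UNIV. {..b i}))"
      using K by (intro compact_imp_seq_compact compact_Times)
    have mem: "\<forall>n. (g n, t n) \<in> K \<times> (\<Pi>\<^sub>E i\<in>UNIV. {..b i})" using g by (auto simp: t_def)
    obtain l r where l: "l \<in> K \<times> (\<Pi>\<^sub>E i\<in>UNIV. {..b i})" and r: "strict_mono r"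
      and lim: "((\<lambda>n. (g n, t n)) \<circ> r) \<longlonglongrightarrow> l"
      using seq_compactE[OF sc mem] by blast
    obtain h \<tau> where [simp]: "l = (h, \<tau>)" by (cases l)
    have lim1: "(\<lambda>n. g (r n)) \<longlonglongrightarrow> h" using tendsto_fst[OF lim] by (simp add: o_def)
    have lim2: "(\<lambda>n. t (r n)) \<longlonglongrightarrow> \<tau>" using tendsto_snd[OF lim] by (simp add: o_def)
    have "\<forall>\<^sub>F n in sequentially. t (r n) i = \<tau> i" for i
    proof -
      have "(\<lambda>n. t (r n) i) \<longlonglongrightarrow> \<tau> i"
        using continuous_on_product_coordinates lim2
        by (rule continuous_on_tendsto_compose) auto
      then show ?thesis by (simp add: tendsto_discrete)
    qed
    moreover have "\<forall>\<^sub>F n in sequentially. i < r n" for i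
      by (rule eventually_compose_filterlim[OF eventually_gt_at_top filterlim_subseq[OF r]])
    ultimately have ev: "\<forall>\<^sub>F n in sequentially. i < r n \<and> s (r n) i = \<tau> i" for i
    proof -
      have "\<forall>\<^sub>F n in sequentially. t (r n) i = \<tau> i \<and> i < r n"
        using \<open>\<forall>\<^sub>F n in sequentially. t (r n) i = \<tau> i\<close> \<open>\<forall>\<^sub>F n in sequentially. i < r n\<close> by (rule eventually_conj)
      then show ?thesis
        by eventually_elim (use gs in \<open>auto simp: t_def min_def\<close>)
    qed
    have ev2: "\<forall>\<^sub>F n in sequentially. s (r n) i = \<tau> i" for i
      using ev[of i] by eventually_elim simp
    have "\<tau> \<in> F"
    proof -
      have "\<exists>\<sigma>\<in>F. \<forall>i<n. \<sigma> i = \<tau> i" for n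
      proof -
        have "\<forall>\<^sub>F k in sequentially. \<forall>i\<in>{..<n}. s (r k) i = \<tau> i"
          using ev2 by (intro eventually_ball_finite) auto
        then have "\<exists>k. \<forall>i\<in>{..<n}. s (r k) i = \<tau> i"
          by (rule eventually_happens'[OF sequentially_bot])
        then obtain k where "\<forall>i\<in>{..<n}. s (r k) i = \<tau> i" ..
        then show ?thesis using s[of "r k"] by auto
      qed
      then show ?thesis by (rule baire_closedD[OF F])
    qed
    moreover have "h \<in> Q i (\<tau> i) \<and> x \<in> P i (\<tau> i)" for i
    proof
      have e: "\<forall>\<^sub>F n in sequentially. g (r n) \<in> Q i (\<tau> i)" "\<forall>\<^sub>F n in sequentially. x \<in> P i (\<tau> i)"
        using ev[of i] by (eventually_elim, use gs in fastforce)+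
      show "h \<in> Q i (\<tau> i)" using Lim_in_closed_set[OF Q e(1) _ lim1] by simp
      show "x \<in> P i (\<tau> i)" using e(2) by simp
    qed
    moreover have "h \<in> K" using l by simp
    ultimately show "x \<in> T F" using xN unfolding T_def by blast
  qed
  ultimately show ?thesis
    using C_sets TF by (intro bexI[of _ "\<Inter>n. C n"]) auto
qed

section \<open>Haar measure and its uniqueness\<close>

lemma image_left_translate: "(\<lambda>g. h + g) ` A = (\<lambda>g. - h + g) -` A" for h :: "'a::group_add"
proof (intro set_eqI iffI)
  fix x assume "x \<in> (\<lambda>g. - h + g) -` A"
  then show "x \<in> (\<lambda>g. h + g) ` A"
    by (intro image_eqI[of _ _ "- h + x"]) (simp_all add: add.assoc[symmetric])
qed (auto simp: add.assoc[symmetric])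

lemma vimage_right_translate: "(\<lambda>g. g + h) -` A = (\<lambda>g. g - h) ` A" for h :: "'a::group_add"
proof (intro set_eqI iffI)
  fix x assume "x \<in> (\<lambda>g. g + h) -` A"
  then show "x \<in> (\<lambda>g. g - h) ` A"
    by (intro image_eqI[of _ _ "x + h"]) simp_all
qed auto

locale lcsc_haar =
  fixes L :: "'g::{topological_group_add, second_countable_topology, t2_space} measure"
  assumes lc: "locally_compact_space (euclidean :: 'g topology)"
    and haar: "left_haar_measure L"
begin

lemma sets_L [simp, measurable_cong]: "sets L = sets borel"
  using haar by (simp add: left_haar_measure_def)

lemma space_L [simp]: "space L = UNIV"
  using sets_eq_imp_space_eq[OF sets_L] by simp

lemma compact_neighbourhood: "\<exists>U K. open U \<and> compact K \<and> (x::'g) \<in> U \<and> U \<subseteq> K"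
proof -
  have "\<forall>x::'g. \<exists>U K. open U \<and> compact K \<and> x \<in> U \<and> U \<subseteq> K"
    using lc unfolding locally_compact_space_def by simp
  then show ?thesis by blast
qed

lemma compact_exhaustion:
  obtains K :: "nat \<Rightarrow> 'g set" where "\<And>n. compact (K n)" "incseq K" "(\<Union>n. K n) = UNIV"
    "\<And>x. \<exists>n. x \<in> interior (K n)"
proof -
  obtain U C where U: "\<And>x::'g. open (U x) \<and> compact (C x) \<and> x \<in> U x \<and> U x \<subseteq> C x"
    using compact_neighbourhood by metis
  obtain F where F: "F \<subseteq> range U" "countable F" "\<Union>F = \<Union>(range U)"
    using Lindelof[of "range U"] U by auto
  have "F \<noteq> {}" using F(3) U by auto
  define f where "f = from_nat_into F"
  have f: "range f = F" using F \<open>F \<noteq> {}\<close> by (simp add: f_def range_from_nat_into)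
  then have "\<forall>n. \<exists>x. f n = U x" using F(1) by blast
  then obtain p where p: "\<And>n. f n = U (p n)" by metis
  define K where "K n = (\<Union>i\<le>n. C (p i))" for n
  have "compact (K n)" for n unfolding K_def using U by (intro compact_UN) auto
  moreover have "incseq K" unfolding K_def incseq_def by fastforce
  moreover have int: "\<exists>n. x \<in> interior (K n)" for x
  proof -
    have "x \<in> \<Union>F" unfolding F(3) using U[of x] by blast
    then obtain n where "x \<in> U (p n)" using f p by (metis UnionE rangeE)
    moreover have "U (p n) \<subseteq> K n" unfolding K_def using U by auto
    ultimately show ?thesis using U by (meson interiorI)
  qed
  moreover have "(\<Union>n. K n) = UNIV" using int interior_subset by blast
  ultimately show ?thesis using that by blast
qed

lemma finite_on_compact: "compact K \<Longrightarrow> emeasure L K < \<infinity>"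
  using haar by (simp add: left_haar_measure_def)

sublocale sigma_finite_measure L
proof
  obtain K :: "nat \<Rightarrow> 'g set" where K: "\<And>n. compact (K n)" "(\<Union>n. K n) = UNIV"
    using compact_exhaustion by metis
  show "\<exists>A. countable A \<and> A \<subseteq> sets L \<and> \<Union> A = space L \<and> (\<forall>a\<in>A. emeasure L a \<noteq> \<infinity>)"
  proof (intro exI[of _ "range K"] conjI ballI)
    show "range K \<subseteq> sets L" using K(1) by (auto intro: borel_compact)
    fix a assume "a \<in> range K" then show "emeasure L a \<noteq> \<infinity>"
      using K(1) finite_on_compact by (auto simp: less_top)
  qed (use K in auto)
qed

lemma measurable_uminus_group [measurable (raw)]:
  fixes f :: "'a \<Rightarrow> 'g"
  assumes "f \<in> borel_measurable N"
  shows "(\<lambda>x. - f x) \<in> borel_measurable N"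
  by (rule borel_measurable_continuous_on[OF _ assms]) (intro continuous_intros)

lemma measurable_diff_group [measurable (raw)]:
  fixes f g :: "'a \<Rightarrow> 'g"
  assumes "f \<in> borel_measurable N" "g \<in> borel_measurable N"
  shows "(\<lambda>x. f x - g x) \<in> borel_measurable N"
  unfolding diff_conv_add_uminus using assms by measurable

lemma emeasure_left_translate:
  assumes "A \<in> sets borel" shows "emeasure L ((\<lambda>g. h + g) ` A) = emeasure L A"
  using haar assms by (simp add: left_haar_measure_def)

lemma distr_left_translate: "distr L borel (\<lambda>g. h + g) = L"
proof (rule measure_eqI)
  fix A assume A: "A \<in> sets (distr L borel (\<lambda>g. h + g))"
  have "(\<lambda>g. h + g) -` A = (\<lambda>g. - h + g) ` A"
    by (simp add: image_left_translate)
  then show "emeasure (distr L borel (\<lambda>g. h + g)) A = emeasure L A"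
    using A by (simp add: emeasure_distr emeasure_left_translate)
qed simp

lemma nn_integral_left_translate:
  assumes [measurable]: "F \<in> borel_measurable borel"
  shows "(\<integral>\<^sup>+ g. F (h + g) \<partial>L) = (\<integral>\<^sup>+ g. F g \<partial>L)"
proof -
  have "(\<integral>\<^sup>+ g. F g \<partial>L) = (\<integral>\<^sup>+ g. F g \<partial>distr L borel (\<lambda>g. h + g))" by (simp add: distr_left_translate)
  also have "\<dots> = (\<integral>\<^sup>+ g. F (h + g) \<partial>L)" by (subst nn_integral_distr) auto
  finally show ?thesis by simp
qed

text \<open>
  Countably many translates of a nonempty open set cover the group.
\<close>

lemma open_positive:
  assumes "open U" "U \<noteq> {}" shows "emeasure L U > 0"
proof (rule ccontr)
  assume "\<not> emeasure L U > 0"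
  then have z: "emeasure L U = 0" by simp
  obtain u where u: "u \<in> U" using assms by blast
  let ?T = "\<lambda>x. (\<lambda>g. (x - u) + g) ` U"
  have op: "open (?T x)" for x
  proof -
    have "?T x = (\<lambda>g. - (x - u) + g) -` U" by (rule image_left_translate)
    moreover have "open ((\<lambda>g. - (x - u) + g) -` U)"
      using assms(1) by (intro open_vimage continuous_intros)
    ultimately show ?thesis by metis
  qed
  obtain F where F: "F \<subseteq> range ?T" "countable F" "\<Union>F = \<Union>(range ?T)"
    using Lindelof[of "range ?T"] op by auto
  have "x \<in> ?T x" for x using u by (intro image_eqI[of _ _ u]) auto
  then have "\<Union>F = UNIV" using F(3) by blast
  have "S \<in> null_sets L" if S: "S \<in> F" for S
  proof -
    obtain x where "S = ?T x" using S F(1) by blast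
    then show ?thesis using z op assms(1) by (auto simp: null_sets_def emeasure_left_translate)
  qed
  then have "\<Union>F \<in> null_sets L" using F(2) by (metis null_sets_UN' image_ident)
  then show False using \<open>\<Union>F = UNIV\<close> haar by (auto simp: left_haar_measure_def null_sets_def)
qed

lemma AE_haar_Ex: assumes "AE g in L. P g" shows "\<exists>g. P g"
proof (rule ccontr)
  assume "\<not> (\<exists>g. P g)"
  with assms have "AE g in L. False" by simp
  then obtain N where "UNIV \<subseteq> N" "N \<in> null_sets L" by (auto simp: eventually_ae_filter)
  then have "emeasure L UNIV = 0" by (metis null_setsD1 top.extremum_unique)
  then show False using haar by (simp add: left_haar_measure_def)
qed

text \<open>
  The indicator of $K$ serves as the function $k$ of lemma \<open>haar_integral_factorization\<close>,
  whose denominators must be positive and finite.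
\<close>

lemma haar_measure_pos_finite_translates:
  obtains K where "compact K" "K \<in> sets borel" "interior K \<noteq> {}" "\<And>x. 0 < emeasure L ((\<lambda>t. t + x) -` K)"
    "\<And>x. emeasure L ((\<lambda>t. t + x) -` K) < \<infinity>"
proof -
  obtain K :: "nat \<Rightarrow> 'g set" where K: "\<And>n. compact (K n)" "\<And>x. \<exists>n. x \<in> interior (K n)"
    using compact_exhaustion by metis
  obtain n where n: "0 \<in> interior (K n)" using K(2) by blast
  show ?thesis
  proof (rule that[of "K n"])
    show "interior (K n) \<noteq> {}" using n by blast
    show "compact (K n)" by (rule K)
    then show "K n \<in> sets borel" by (rule borel_compact)
    fix x
    have "open ((\<lambda>t. t + x) -` interior (K n))" by (intro open_vimage continuous_intros) auto
    moreover have "- x \<in> (\<lambda>t. t + x) -` interior (K n)" using n by simp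
    ultimately have "0 < emeasure L ((\<lambda>t. t + x) -` interior (K n))" using open_positive by blast
    also have "\<dots> \<le> emeasure L ((\<lambda>t. t + x) -` K n)"
      using K(1)[THEN borel_compact] interior_subset
      by (intro emeasure_mono) (auto intro!: measurable_sets_borel[of _ borel])
    finally show "0 < emeasure L ((\<lambda>t. t + x) -` K n)" .
    have "(\<lambda>t. t + x) -` K n = (\<lambda>t. t - x) ` K n"
      by (rule vimage_right_translate)
    moreover have "compact ((\<lambda>t. t - x) ` K n)"
      using K(1) by (intro compact_continuous_image continuous_intros)
    ultimately show "emeasure L ((\<lambda>t. t + x) -` K n) < \<infinity>" using finite_on_compact by simp
  qed
qed

end

text \<open>
  The uniqueness of Haar measure by Fubini's theorem: insert the factor $1 = \int k(y+x)\,dL(y) / \int k(t+x)\,dL(t)$ into the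
  integral of $f$ and substitute $x \mapsto -y+x$, then $y \mapsto x+y$. Left invariance of both measures
  separates the variables. The second factor does not involve $L'$, whence
  all left Haar measures are proportional to each other.
\<close>

lemma haar_integral_factorization:
  assumes "lcsc_haar L" "lcsc_haar L'"
    and [measurable]: "f \<in> borel_measurable borel" "k \<in> borel_measurable borel"
    and pos: "\<And>x. 0 < (\<integral>\<^sup>+ t. k (t + x) \<partial>L)" and fin: "\<And>x. (\<integral>\<^sup>+ t. k (t + x) \<partial>L) < \<infinity>"
  shows "(\<integral>\<^sup>+ x. f x \<partial>L') = (\<integral>\<^sup>+ x. k x \<partial>L') * (\<integral>\<^sup>+ y. f (- y) / (\<integral>\<^sup>+ t. k (t - y) \<partial>L) \<partial>L)"
proof -
  interpret L: lcsc_haar L by fact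
  interpret L': lcsc_haar L' by fact
  interpret P: pair_sigma_finite L L' ..
  define \<kappa> where "\<kappa> x = (\<integral>\<^sup>+ t. k (t + x) \<partial>L)" for x
  have [measurable]: "\<kappa> \<in> borel_measurable borel" unfolding \<kappa>_def by measurable
  have \<kappa>: "\<kappa> x \<noteq> 0" "\<kappa> x \<noteq> \<infinity>" for x using pos[of x] fin[of x] by (auto simp: \<kappa>_def)
  have "(\<integral>\<^sup>+ x. f x \<partial>L') = (\<integral>\<^sup>+ x. (\<integral>\<^sup>+ y. f x * k (y + x) / \<kappa> x \<partial>L) \<partial>L')"
  proof (rule nn_integral_cong)
    fix x
    have "(\<integral>\<^sup>+ y. f x * k (y + x) / \<kappa> x \<partial>L) = (\<integral>\<^sup>+ y. (f x / \<kappa> x) * k (y + x) \<partial>L)"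
      by (simp add: ennreal_times_divide mult.commute)
    also have "\<dots> = (f x / \<kappa> x) * \<kappa> x" by (subst nn_integral_cmult) (auto simp: \<kappa>_def)
    also have "\<dots> = f x" using \<kappa>[of x] by (simp add: ennreal_divide_times ennreal_divide_self less_top)
    finally show "f x = (\<integral>\<^sup>+ y. f x * k (y + x) / \<kappa> x \<partial>L)" ..
  qed
  also have "\<dots> = (\<integral>\<^sup>+ y. (\<integral>\<^sup>+ x. f x * k (y + x) / \<kappa> x \<partial>L') \<partial>L)"
    by (intro P.Fubini') measurable
  also have "\<dots> = (\<integral>\<^sup>+ y. (\<integral>\<^sup>+ x. f (- y + x) * k x / \<kappa> (- y + x) \<partial>L') \<partial>L)"
  proof (rule nn_integral_cong)
    fix y
    have "(\<integral>\<^sup>+ x. f x * k (y + x) / \<kappa> x \<partial>L') = (\<integral>\<^sup>+ x. f (- y + x) * k (y + (- y + x)) / \<kappa> (- y + x) \<partial>L')"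
      by (rule L'.nn_integral_left_translate[symmetric]) measurable
    then show "(\<integral>\<^sup>+ x. f x * k (y + x) / \<kappa> x \<partial>L') = (\<integral>\<^sup>+ x. f (- y + x) * k x / \<kappa> (- y + x) \<partial>L')"
      by (simp add: add.assoc[symmetric])
  qed
  also have "\<dots> = (\<integral>\<^sup>+ x. (\<integral>\<^sup>+ y. f (- y + x) * k x / \<kappa> (- y + x) \<partial>L) \<partial>L')"
    by (intro P.Fubini'[symmetric]) measurable
  also have "\<dots> = (\<integral>\<^sup>+ x. k x * (\<integral>\<^sup>+ y. f (- y) / \<kappa> (- y) \<partial>L) \<partial>L')"
  proof (rule nn_integral_cong)
    fix x
    have "(\<integral>\<^sup>+ y. f (- y + x) * k x / \<kappa> (- y + x) \<partial>L) = (\<integral>\<^sup>+ y. f (- (x + y) + x) * k x / \<kappa> (- (x + y) + x) \<partial>L)"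
      by (rule L.nn_integral_left_translate[symmetric]) measurable
    also have "\<dots> = (\<integral>\<^sup>+ y. k x * (f (- y) / \<kappa> (- y)) \<partial>L)"
      by (simp add: minus_add add.assoc ennreal_times_divide mult.commute)
    also have "\<dots> = k x * (\<integral>\<^sup>+ y. f (- y) / \<kappa> (- y) \<partial>L)" by (rule nn_integral_cmult) measurable
    finally show "(\<integral>\<^sup>+ y. f (- y + x) * k x / \<kappa> (- y + x) \<partial>L) = k x * (\<integral>\<^sup>+ y. f (- y) / \<kappa> (- y) \<partial>L)" .
  qed
  also have "\<dots> = (\<integral>\<^sup>+ x. k x \<partial>L') * (\<integral>\<^sup>+ y. f (- y) / \<kappa> (- y) \<partial>L)"
    by (rule nn_integral_multc) measurable
  finally show ?thesis by (simp add: \<kappa>_def)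
qed

theorem haar_measure_unique:
  assumes "lcsc_haar L" "lcsc_haar L'"
  obtains c where "0 < c" "c < \<infinity>"
    "\<And>f. f \<in> borel_measurable borel \<Longrightarrow> (\<integral>\<^sup>+ x. f x \<partial>L') = c * (\<integral>\<^sup>+ x. f x \<partial>L)"
proof -
  interpret L: lcsc_haar L by fact
  interpret L': lcsc_haar L' by fact
  obtain K where K: "compact K" "K \<in> sets borel" "interior K \<noteq> {}" and pos: "\<And>x. 0 < emeasure L ((\<lambda>t. t + x) -` K)"
    and fin: "\<And>x. emeasure L ((\<lambda>t. t + x) -` K) < \<infinity>"
    using L.haar_measure_pos_finite_translates by metis
  have pos': "emeasure L' K > 0"
  proof -
    have "0 < emeasure L' (interior K)" using K by (intro L'.open_positive) auto
    also have "\<dots> \<le> emeasure L' K" using K interior_subset by (intro emeasure_mono) auto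
    finally show ?thesis .
  qed
  have eq: "(\<integral>\<^sup>+ t. indicator K (t + x) \<partial>L) = emeasure L ((\<lambda>t. t + x) -` K)" for x
  proof -
    have "(\<lambda>t. t + x) -` K \<in> sets L" using K by (auto intro!: measurable_sets_borel[of _ borel])
    moreover have "(\<lambda>t. indicator K (t + x)) = (indicator ((\<lambda>t. t + x) -` K) :: _ \<Rightarrow> ennreal)"
      by (auto simp: indicator_def)
    ultimately show ?thesis by simp
  qed
  define J where "J f = (\<integral>\<^sup>+ y. f (- y) / (\<integral>\<^sup>+ t. indicator K (t - y) \<partial>L) \<partial>L)" for f :: "'a \<Rightarrow> ennreal"
  have J: "(\<integral>\<^sup>+ x. f x \<partial>L) = emeasure L K * J f" "(\<integral>\<^sup>+ x. f x \<partial>L') = emeasure L' K * J f"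
    if "f \<in> borel_measurable borel" for f
    using haar_integral_factorization[OF assms(1) assms(1) that, of "indicator K"]
      haar_integral_factorization[OF assms that, of "indicator K"] K pos fin
    by (simp_all add: eq J_def)
  have LK: "0 < emeasure L K" "emeasure L K < \<infinity>" "emeasure L' K < \<infinity>"
    using pos[of 0] fin[of 0] L'.finite_on_compact K by auto
  show ?thesis
  proof (rule that[of "emeasure L' K / emeasure L K"])
    show "0 < emeasure L' K / emeasure L K" "emeasure L' K / emeasure L K < \<infinity>"
      using LK pos' by (auto simp: ennreal_zero_less_divide ennreal_divide_eq_top_iff less_top[symmetric])
    fix f :: "'a \<Rightarrow> ennreal" assume f: "f \<in> borel_measurable borel"
    have "emeasure L' K / emeasure L K * (emeasure L K * J f) = emeasure L' K * J f"
      using LK by (simp add: mult.assoc[symmetric] ennreal_divide_times ennreal_mult_divide_eq)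
    then show "(\<integral>\<^sup>+ x. f x \<partial>L') = emeasure L' K / emeasure L K * (\<integral>\<^sup>+ x. f x \<partial>L)"
      using J[OF f] by simp
  qed
qed

text \<open>
  The constant is a value of the modular function.
\<close>

lemma (in lcsc_haar) nn_integral_right_translate:
  obtains c where "0 < c" "c < \<infinity>"
    "\<And>F. F \<in> borel_measurable borel \<Longrightarrow> (\<integral>\<^sup>+ g. F (g + h) \<partial>L) = c * (\<integral>\<^sup>+ g. F g \<partial>L)"
proof -
  let ?L = "distr L borel (\<lambda>g. g + h)"
  have "left_haar_measure ?L"
    unfolding left_haar_measure_def
  proof (intro conjI allI ballI impI)
    fix g :: 'g and A :: "'g set" assume A: "A \<in> sets borel"
    have gA: "(\<lambda>h. g + h) ` A = (\<lambda>h. - g + h) -` A"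
      by (rule image_left_translate)
    then have m: "(\<lambda>h. g + h) ` A \<in> sets borel"
      using A by (auto intro!: measurable_sets_borel[of _ borel])
    have "(\<lambda>t. t + h) -` (\<lambda>h. g + h) ` A = (\<lambda>k. g + k) ` ((\<lambda>t. t + h) -` A)"
      unfolding image_left_translate by (auto simp: add.assoc)
    then show "emeasure ?L ((\<lambda>h. g + h) ` A) = emeasure ?L A"
      using A m by (simp add: emeasure_distr emeasure_left_translate measurable_sets_borel[of _ borel])
  next
    fix K :: "'g set" assume K: "compact K"
    have "(\<lambda>t. t + h) -` K = (\<lambda>t. t - h) ` K"
      by (rule vimage_right_translate)
    moreover have "compact ((\<lambda>t. t - h) ` K)"
      using K by (intro compact_continuous_image continuous_intros)
    ultimately show "emeasure ?L K < \<infinity>" using finite_on_compact K by (simp add: emeasure_distr borel_compact)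
  next
    show "emeasure ?L UNIV \<noteq> 0" using haar by (simp add: emeasure_distr left_haar_measure_def)
  qed simp
  then have "lcsc_haar ?L" using lc by (simp add: lcsc_haar_def)
  then obtain c where c: "0 < c" "c < \<infinity>"
    "\<And>f. f \<in> borel_measurable borel \<Longrightarrow> (\<integral>\<^sup>+ x. f x \<partial>?L) = c * (\<integral>\<^sup>+ x. f x \<partial>L)"
    using haar_measure_unique[OF lcsc_haar_axioms] by metis
  show ?thesis
    using that[OF c(1,2)] c(3) by (simp add: nn_integral_distr)
qed

section \<open>Lexicographic maxima\<close>

text \<open>
  This implies that the sequence $F_0(h), F_1(h), \dots$ is lexicographically greatest, and is equivalent to it
  if the $F_j$ are continuous and $F_0$ vanishes at infinity and takes a positive value. The
  approximate form serves measurability: it involves no suprema, and a violation by some $k$ is an open condition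
  on $k$, so that it is enough to test a countable dense set of $k$.
\<close>

definition lex_maximal :: "(nat \<Rightarrow> 'g \<Rightarrow> real) \<Rightarrow> 'g \<Rightarrow> bool" where
  "lex_maximal F h \<longleftrightarrow>
     (\<forall>j. \<forall>e>0. \<exists>d>0. \<forall>k. (\<forall>i<j. F i k > F i h - d) \<longrightarrow> F j k \<le> F j h + e)"

lemma lex_maximal_le:
  assumes "lex_maximal F h" "\<And>i. i < j \<Longrightarrow> F i k = F i h"
  shows "F j k \<le> F j h"
proof (rule field_le_epsilon)
  fix e :: real assume "e > 0"
  then obtain d where "d > 0" "\<forall>k. (\<forall>i<j. F i k > F i h - d) \<longrightarrow> F j k \<le> F j h + e"
    using assms(1) unfolding lex_maximal_def by blast
  then show "F j k \<le> F j h + e" using assms(2) by simp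
qed

lemma lex_maximal_value_unique:
  assumes "lex_maximal F h" "lex_maximal F k"
  shows "F j h = F j k"
proof (induction j rule: less_induct)
  case (less j)
  show ?case
    using lex_maximal_le[OF assms(1), of j k] lex_maximal_le[OF assms(2), of j h] less
    by (metis antisym)
qed

text \<open>
  Maximize $F_0$, then $F_1$ on the set of maximizers, and so on. These sets are compact, the first one because
  $F_0$ vanishes at infinity, and they decrease, so they have a common point. The approximate form of
  maximality follows by a second compactness argument.
\<close>

lemma lex_maximal_exists:
  fixes F :: "nat \<Rightarrow> 'g::t2_space \<Rightarrow> real"
  assumes cont: "\<And>j. continuous_on UNIV (F j)"
    and vanish: "\<And>e. e > 0 \<Longrightarrow> \<exists>C. compact C \<and> (\<forall>h. h \<notin> C \<longrightarrow> F 0 h < e)"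
    and pos: "F 0 h1 > 0"
  shows "\<exists>h. lex_maximal F h"
proof -
  have cont': "continuous_on S (F j)" for S j using cont continuous_on_subset by blast
  have closed_ge: "closed {h. c \<le> F j h}" for c j
    by (intro closed_Collect_le continuous_intros cont)
  have closed_all: "closed {k. \<forall>i<j::nat. f i \<le> F i k}" for f j
  proof -
    have "{k. \<forall>i<j. f i \<le> F i k} = (\<Inter>i\<in>{..<j}. {k. f i \<le> F i k})" by auto
    moreover have "closed \<dots>" by (intro closed_INT ballI closed_ge)
    ultimately show ?thesis by simp
  qed
  (* A j consists of the points at which F 0, ..., F j are successively maximal. *)
  define A where "A = rec_nat {h. \<forall>k. F 0 k \<le> F 0 h} (\<lambda>j A. {h\<in>A. \<forall>k\<in>A. F (Suc j) k \<le> F (Suc j) h})"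
  have A0: "A 0 = {h. \<forall>k. F 0 k \<le> F 0 h}" by (simp add: A_def)
  have ASuc: "A (Suc j) = {h\<in>A j. \<forall>k\<in>A j. F (Suc j) k \<le> F (Suc j) h}" for j by (simp add: A_def)
  have A: "compact (A j) \<and> A j \<noteq> {}" for j
  proof (induction j)
    case 0
    obtain C where C: "compact C" "\<And>h. h \<notin> C \<Longrightarrow> F 0 h < F 0 h1" using vanish[OF pos] by blast
    then have "h1 \<in> C" by blast
    then obtain h0 where h0: "h0 \<in> C" "\<And>h. h \<in> C \<Longrightarrow> F 0 h \<le> F 0 h0"
      using continuous_attains_sup[OF C(1) _ cont', of 0] by blast
    have max: "F 0 h \<le> F 0 h0" for h
      using h0(2)[of h] h0(2)[OF \<open>h1 \<in> C\<close>] C(2)[of h] by fastforce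
    have "A 0 = C \<inter> {h. F 0 h0 \<le> F 0 h}"
      unfolding A0
    proof (intro set_eqI iffI)
      fix h assume "h \<in> {h. \<forall>k. F 0 k \<le> F 0 h}"
      then have le: "F 0 k \<le> F 0 h" for k by blast
      then have "h \<in> C" using C(2)[of h] le[of h1] by fastforce
      then show "h \<in> C \<inter> {h. F 0 h0 \<le> F 0 h}" using le by blast
    next
      fix h assume "h \<in> C \<inter> {h. F 0 h0 \<le> F 0 h}"
      then show "h \<in> {h. \<forall>k. F 0 k \<le> F 0 h}" using max order_trans by blast
    qed
    then show ?case using C(1) closed_ge[of "F 0 h0" 0] h0(1) by (auto intro: compact_Int_closed)
  next
    case (Suc j)
    then obtain h0 where h0: "h0 \<in> A j" "\<And>h. h \<in> A j \<Longrightarrow> F (Suc j) h \<le> F (Suc j) h0"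
      using continuous_attains_sup[of "A j", OF _ _ cont', of "Suc j"] by blast
    have "A (Suc j) = A j \<inter> {h. F (Suc j) h0 \<le> F (Suc j) h}"
      unfolding ASuc using h0 order_trans by blast
    then show ?case using Suc closed_ge[of "F (Suc j) h0" "Suc j"] h0(1) by (auto intro: compact_Int_closed)
  qed
  have dec: "A j \<subseteq> A i" if "i \<le> j" for i j
    using that by (induction rule: dec_induct) (auto simp: ASuc)
  have "A 0 \<inter> (\<Inter>j\<in>UNIV. A j) \<noteq> {}"
  proof (rule compact_imp_fip_image)
    fix I' :: "nat set" assume "finite I'"
    then have "A (Max (insert 0 I')) \<subseteq> A 0 \<inter> (\<Inter>i\<in>I'. A i)" using dec by (simp add: le_INF_iff)
    then show "A 0 \<inter> (\<Inter>i\<in>I'. A i) \<noteq> {}" using A by blast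
  qed (use A compact_imp_closed in auto)
  then obtain h0 where h0: "\<And>j. h0 \<in> A j" by blast
  have h0_pos: "F 0 h0 > 0" using h0[of 0] pos unfolding A0 by (auto intro: less_le_trans)
  have "lex_maximal F h0"
  proof (rule ccontr)
    assume "\<not> lex_maximal F h0"
    then obtain j e where "e > 0"
      and bad: "\<And>d. d > 0 \<Longrightarrow> \<exists>k. (\<forall>i<j. F i k > F i h0 - d) \<and> F j k > F j h0 + e"
      unfolding lex_maximal_def by (meson not_le)
    have "j \<noteq> 0"
    proof
      assume "j = 0"
      then obtain k where "F 0 k > F 0 h0 + e" using bad[of 1] by auto
      moreover have "F 0 k \<le> F 0 h0" using h0[of 0] by (simp add: A0)
      ultimately show False using \<open>e > 0\<close> by simp
    qed
    define d0 where "d0 = F 0 h0 / 2"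
    have "d0 > 0" using h0_pos by (simp add: d0_def)
    then obtain C where C: "compact C" "\<And>h. h \<notin> C \<Longrightarrow> F 0 h < d0" using vanish by blast
    (* A common point of all Z d beats h0 at index j and ties with or beats it at every smaller index. *)
    define Z where "Z d = {k. \<forall>i<j. F i h0 - d \<le> F i k} \<inter> {k. F j h0 + e \<le> F j k}" for d
    have "C \<inter> (\<Inter>d\<in>{0<..}. Z d) \<noteq> {}"
    proof (rule compact_imp_fip_image)
      show "closed (Z d)" for d
        unfolding Z_def by (intro closed_Int closed_all closed_ge)
      fix I' :: "real set" assume I': "finite I'" "I' \<subseteq> {0<..}"
      define d where "d = Min (insert d0 I')"
      have "d > 0" using I' \<open>d0 > 0\<close> by (auto simp: d_def)
      then obtain k where k: "\<And>i. i < j \<Longrightarrow> F i k > F i h0 - d" "F j k > F j h0 + e" using bad by blast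
      have "d \<le> d0" unfolding d_def using I' by simp
      then have "F 0 k > d0" using k(1)[of 0] \<open>j \<noteq> 0\<close> by (simp add: d0_def)
      then have "k \<in> C" using C(2)[of k] by fastforce
      moreover have "k \<in> Z d'" if "d' \<in> I'" for d'
      proof -
        have "d \<le> d'" unfolding d_def using I' that by simp
        then show ?thesis unfolding Z_def using k by force
      qed
      ultimately show "C \<inter> (\<Inter>d\<in>I'. Z d) \<noteq> {}" by blast
    qed (rule C)
    then obtain k where k: "\<And>d. d > 0 \<Longrightarrow> k \<in> Z d" by auto
    have ge: "F i h0 \<le> F i k" if "i < j" for i
    proof (rule field_le_epsilon)
      fix d :: real assume "d > 0"
      then show "F i h0 \<le> F i k + d" using k[of d] that by (auto simp: Z_def diff_le_eq)
    qed
    have kA: "i < j \<Longrightarrow> k \<in> A i" for i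
    proof (induction i)
      case 0
      then show ?case using ge[of 0] h0[of 0] unfolding A0 by (auto intro: order_trans)
    next
      case (Suc i)
      then show ?case using ge[of "Suc i"] h0[of "Suc i"] unfolding ASuc by (auto intro: order_trans)
    qed
    obtain i where "j = Suc i" using \<open>j \<noteq> 0\<close> not0_implies_Suc by blast
    then have "F j k \<le> F j h0" using kA[of i] h0[of j] by (auto simp: ASuc)
    moreover have "F j h0 + e \<le> F j k" using k[of 1] by (simp add: Z_def)
    ultimately show False using \<open>e > 0\<close> by simp
  qed
  then show ?thesis by blast
qed

lemma lex_maximal_dense:
  fixes F :: "nat \<Rightarrow> 'g::topological_space \<Rightarrow> real"
  assumes cont: "\<And>j. continuous_on UNIV (F j)"
    and dense: "\<And>U. open U \<Longrightarrow> U \<noteq> {} \<Longrightarrow> \<exists>k\<in>D. k \<in> U"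
  shows "lex_maximal F h \<longleftrightarrow>
    (\<forall>j n. \<exists>m. \<forall>k\<in>D. (\<forall>i<j. F i k > F i h - 1 / real (Suc m)) \<longrightarrow> F j k \<le> F j h + 1 / real (Suc n))"
  (is "_ \<longleftrightarrow> ?R")
proof
  assume L: "lex_maximal F h"
  show ?R
  proof (intro allI)
    fix j n
    obtain d where d: "d > 0" "\<forall>k. (\<forall>i<j. F i k > F i h - d) \<longrightarrow> F j k \<le> F j h + 1 / real (Suc n)"
      using L unfolding lex_maximal_def by (metis of_nat_0_less_iff zero_less_Suc zero_less_divide_1_iff)
    obtain m where "1 / real (Suc m) < d" using nat_approx_posE[OF d(1)] by metis
    then show "\<exists>m. \<forall>k\<in>D. (\<forall>i<j. F i k > F i h - 1 / real (Suc m)) \<longrightarrow> F j k \<le> F j h + 1 / real (Suc n)"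
      using d(2) by (intro exI[of _ m]) force
  qed
next
  assume R: ?R
  show "lex_maximal F h"
    unfolding lex_maximal_def
  proof (intro allI impI)
    fix j and e :: real assume "e > 0"
    then obtain n where n: "1 / real (Suc n) < e" using nat_approx_posE by metis
    obtain m where m: "\<And>k. k \<in> D \<Longrightarrow> (\<forall>i<j. F i k > F i h - 1 / real (Suc m)) \<Longrightarrow> F j k \<le> F j h + 1 / real (Suc n)"
      using R by blast
    have "F j k \<le> F j h + e" if k: "\<forall>i<j. F i k > F i h - 1 / real (Suc m)" for k
    proof (rule ccontr)
      assume "\<not> F j k \<le> F j h + e"
      let ?U = "(\<Inter>i\<in>{..<j}. {k. F i h - 1 / real (Suc m) < F i k}) \<inter> {k. F j h + 1 / real (Suc n) < F j k}"
      have "open ?U"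
        by (intro open_Int open_INT ballI open_Collect_less continuous_intros cont) auto
      moreover have "k \<in> ?U" using k n \<open>\<not> F j k \<le> F j h + e\<close> by auto
      ultimately obtain k' where "k' \<in> D" "k' \<in> ?U" using dense[of ?U] by blast
      then show False using m[of k'] by auto
    qed
    then show "\<exists>d>0. \<forall>k. (\<forall>i<j. F i k > F i h - d) \<longrightarrow> F j k \<le> F j h + e"
      by (intro exI[of _ "1 / real (Suc m)"]) auto
  qed
qed

section \<open>Test functions on the group\<close>

context lcsc_haar begin

lemma Hausdorff_G: "Hausdorff_space (euclidean :: 'g topology)"
  unfolding Hausdorff_space_def disjnt_def using hausdorff by (auto simp: open_openin[symmetric])

text \<open>
  Complete regularity gives, for each point of $V$, a function that is positive there and vanishes off $V$. By the
  Lindeloef property countably many of them suffice, and truncated multiples of their partial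
  sums tend to the indicator of $V$.
\<close>

lemma indicator_open_approx:
  assumes V: "open (V :: 'g set)"
  obtains \<phi> :: "nat \<Rightarrow> 'g \<Rightarrow> real" where "\<And>m. continuous_on UNIV (\<phi> m)"
    "\<And>m g. 0 \<le> \<phi> m g" "\<And>m g. \<phi> m g \<le> 1" "\<And>m g. g \<notin> V \<Longrightarrow> \<phi> m g = 0"
    "\<And>g. g \<in> V \<Longrightarrow> \<forall>\<^sub>F m in sequentially. \<phi> m g = 1"
proof -
  have cr: "completely_regular_space (euclidean :: 'g topology)"
    using lc Hausdorff_G by (intro locally_compact_regular_imp_completely_regular_space) auto
  have "\<exists>h::'g \<Rightarrow> real. continuous_on UNIV h \<and> (\<forall>g. 0 \<le> h g) \<and> (\<forall>g. g \<notin> V \<longrightarrow> h g = 0) \<and> (x \<in> V \<longrightarrow> h x > 0)" for x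
  proof (cases "x \<in> V")
    case True
    then obtain f :: "'g \<Rightarrow> real" where f: "continuous_map euclidean (top_of_set {0..1}) f" "f x = 0" "f ` (- V) \<subseteq> {1}"
      using cr V unfolding completely_regular_space_def
      by (metis Compl_iff DiffI UNIV_I closed_Compl closed_closedin double_complement topspace_euclidean)
    have "continuous_on UNIV f" "\<And>g. f g \<in> {0..1}"
      using f(1) by (auto simp: continuous_map_in_subtopology)
    then show ?thesis
      using f(2,3) by (intro exI[of _ "\<lambda>g. 1 - f g"]) (auto intro!: continuous_intros)
  next
    case False
    then show ?thesis by (intro exI[of _ "\<lambda>_. 0"]) auto
  qed
  then obtain h :: "'g \<Rightarrow> 'g \<Rightarrow> real" where h: "\<And>x. continuous_on UNIV (h x)" "\<And>x g. 0 \<le> h x g"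
    "\<And>x g. g \<notin> V \<Longrightarrow> h x g = 0" "\<And>x. x \<in> V \<Longrightarrow> h x x > 0" by metis
  have op: "open {g. 0 < h x g}" for x
    by (intro open_Collect_less continuous_intros h)
  obtain F where F: "F \<subseteq> range (\<lambda>x. {g. 0 < h x g})" "countable F" "\<Union>F = (\<Union>x. {g. 0 < h x g})"
    using Lindelof[of "range (\<lambda>x. {g. 0 < h x g})"] op by auto
  obtain D where D: "countable D" "F = (\<lambda>x. {g. 0 < h x g}) ` D"
    using countable_subset_image[of F "\<lambda>x. {g. 0 < h x g}" UNIV] F(1,2) by blast
  define p where "p = from_nat_into (insert undefined D)"
  have p: "range p = insert undefined D" unfolding p_def by (rule range_from_nat_into) (use D in auto)
  define \<phi> where "\<phi> m g = min 1 (real m * (\<Sum>k<m. h (p k) g))" for m g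
  show ?thesis
  proof (rule that[of \<phi>])
    show "continuous_on UNIV (\<phi> m)" for m unfolding \<phi>_def by (intro continuous_intros h)
    show "0 \<le> \<phi> m g" "\<phi> m g \<le> 1" for m g by (auto simp: \<phi>_def h intro!: mult_nonneg_nonneg sum_nonneg)
    show "\<phi> m g = 0" if "g \<notin> V" for m g using that by (simp add: \<phi>_def h)
    fix g assume "g \<in> V"
    then have "g \<in> \<Union>F" unfolding F(3) using h(4) by blast
    then obtain x where x: "x \<in> D" "0 < h x g" using D(2) by blast
    then have "x \<in> range p" using p by simp
    then obtain k where "x = p k" by (rule rangeE)
    with x have k: "0 < h (p k) g" by simp
    obtain N where N: "1 / h (p k) g < real N" using reals_Archimedean2 by blast
    have "\<phi> m g = 1" if "m \<ge> max (Suc k) N" for m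
    proof -
      have "1 \<le> real m * h (p k) g"
        using N k that by (auto simp: divide_less_eq intro: order_trans[OF less_imp_le mult_right_mono])
      also have "\<dots> \<le> real m * (\<Sum>k<m. h (p k) g)"
        using that h(2) by (intro mult_left_mono member_le_sum) auto
      finally show ?thesis by (simp add: \<phi>_def)
    qed
    then show "\<forall>\<^sub>F m in sequentially. \<phi> m g = 1" by (rule eventually_sequentiallyI)
  qed
qed

lemma open_Fsigma:
  assumes V: "open (V :: 'g set)"
  shows "\<exists>C::nat \<Rightarrow> 'g set. (\<forall>n. closed (C n)) \<and> V = (\<Union>n. C n)"
proof -
  obtain \<phi> :: "nat \<Rightarrow> 'g \<Rightarrow> real" where \<phi>: "\<And>m. continuous_on UNIV (\<phi> m)"
    "\<And>m g. g \<notin> V \<Longrightarrow> \<phi> m g = 0" "\<And>g. g \<in> V \<Longrightarrow> \<forall>\<^sub>F m in sequentially. \<phi> m g = 1"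
    using indicator_open_approx[OF V] by metis
  have "closed {g. \<phi> m g = 1}" for m by (intro closed_Collect_eq continuous_intros \<phi>)
  moreover have "V = (\<Union>m. {g. \<phi> m g = 1})"
  proof (intro set_eqI iffI)
    fix g assume "g \<in> V"
    then show "g \<in> (\<Union>m. {g. \<phi> m g = 1})"
      using eventually_happens'[OF sequentially_bot \<phi>(3)] by blast
  next
    fix g assume "g \<in> (\<Union>m. {g. \<phi> m g = 1})"
    then show "g \<in> V" using \<phi>(2) by force
  qed
  ultimately show ?thesis by (intro exI[of _ "\<lambda>m. {g. \<phi> m g = 1}"] conjI allI)
qed

text \<open>
  The relatively compact open sets of a countable basis, closed up under finite intersections, form a countable
  generating $\pi$-system of the Borel sets. The functions are continuous approximations of
  their indicators, hence compactly supported.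
\<close>

lemma measure_determining_functions:
  obtains u :: "nat \<Rightarrow> 'g \<Rightarrow> real"
  where "\<And>i. continuous_on UNIV (u i)" "\<And>i g. 0 \<le> u i g" "\<And>i g. u i g \<le> 1"
    "\<And>i. \<exists>C. compact C \<and> (\<forall>g. g \<notin> C \<longrightarrow> u i g = 0)" "\<exists>g. u 0 g > 0"
    "\<And>q q'. finite_measure q \<Longrightarrow> finite_measure q' \<Longrightarrow> sets q = sets borel \<Longrightarrow> sets q' = sets borel \<Longrightarrow>
       (\<And>i. (\<integral>\<^sup>+ g. ennreal (u i g) \<partial>q) = (\<integral>\<^sup>+ g. ennreal (u i g) \<partial>q')) \<Longrightarrow> q = q'"
proof -
  obtain \<B> :: "'g set set" where \<B>: "countable \<B>" "topological_basis \<B>"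
    using ex_countable_basis by blast
  define R where "R = {U\<in>\<B>. \<exists>C. compact C \<and> U \<subseteq> C}"
  define S where "S = Inter ` ({\<F>. finite \<F> \<and> \<F> \<subseteq> R} - {{}})"
  have R_open: "open U" if "U \<in> R" for U using that \<B>(2) topological_basis_open by (auto simp: R_def)
  have R_basis: "\<exists>U\<in>R. x \<in> U \<and> U \<subseteq> W" if W: "open W" "x \<in> W" for x W
  proof -
    obtain V C where VC: "open V" "compact C" "x \<in> V" "V \<subseteq> C"
      using compact_neighbourhood[of x] by blast
    have "open (W \<inter> V)" "x \<in> W \<inter> V" using W VC by auto
    then obtain U where "U \<in> \<B>" "x \<in> U" "U \<subseteq> W \<inter> V"
      using topological_basisE[OF \<B>(2)] by metis
    then have "U \<in> R" unfolding R_def using VC by blast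
    then show ?thesis using \<open>x \<in> U\<close> \<open>U \<subseteq> W \<inter> V\<close> by blast
  qed
  have "countable R" unfolding R_def using \<B>(1) by auto
  then have cS: "countable S" unfolding S_def by (intro countable_image countable_Diff countable_Collect_finite_subset)
  have S_open: "open U" if "U \<in> S" for U using that R_open by (auto simp: S_def intro!: open_Inter)
  have S_cpt: "\<exists>C. compact C \<and> U \<subseteq> C" if US: "U \<in> S" for U
  proof -
    obtain \<F> where \<F>: "\<F> \<subseteq> R" "\<F> \<noteq> {}" "U = \<Inter>\<F>" using US by (auto simp: S_def)
    then obtain V where V: "V \<in> \<F>" by blast
    then have "U \<subseteq> V" using \<F>(3) by blast
    moreover have "V \<in> R" using V \<F>(1) by blast
    then obtain C where "compact C" "V \<subseteq> C" by (auto simp: R_def)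
    ultimately show ?thesis by blast
  qed
  have RS: "R \<subseteq> S"
  proof
    fix U assume "U \<in> R" then show "U \<in> S" unfolding S_def by (intro image_eqI[of _ _ "{U}"]) auto
  qed
  have S_Int: "Int_stable S"
  proof (rule Int_stableI)
    fix a b assume "a \<in> S" "b \<in> S"
    then obtain \<F> \<G> where "finite \<F>" "\<F> \<subseteq> R" "\<F> \<noteq> {}" "a = \<Inter>\<F>" "finite \<G>" "\<G> \<subseteq> R" "\<G> \<noteq> {}" "b = \<Inter>\<G>"
      unfolding S_def by blast
    then show "a \<inter> b \<in> S" unfolding S_def by (intro image_eqI[of _ _ "\<F> \<union> \<G>"]) auto
  qed
  have S_basis: "topological_basis S"
  proof (rule topological_basisI)
    fix W and x :: 'g assume "open W" "x \<in> W"
    then obtain U where "U \<in> R" "x \<in> U \<and> U \<subseteq> W" using R_basis by metis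
    then show "\<exists>U\<in>S. x \<in> U \<and> U \<subseteq> W" using RS by (intro bexI[of _ U]) auto
  qed (rule S_open)
  have S_borel: "sets borel = sigma_sets UNIV S"
    unfolding borel_eq_countable_basis[OF cS S_basis] by (rule sets_measure_of) simp
  obtain U0 where U0: "U0 \<in> S" "0 \<in> U0" using R_basis[OF open_UNIV, of 0] RS by blast
  define s where "s = from_nat_into S"
  have s: "range s = S" unfolding s_def using U0 cS by (intro range_from_nat_into) auto
  then have s_open: "open (s i)" for i using S_open by blast
  define approx where "approx V \<phi> \<longleftrightarrow> (\<forall>m. continuous_on UNIV (\<phi> m)) \<and>
    (\<forall>m g. 0 \<le> \<phi> m g \<and> \<phi> m g \<le> 1 \<and> (g \<notin> V \<longrightarrow> \<phi> m g = 0)) \<and>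
    (\<forall>g\<in>V. \<forall>\<^sub>F m in sequentially. \<phi> m g = 1)" for V and \<phi> :: "nat \<Rightarrow> 'g \<Rightarrow> real"
  have "\<exists>\<phi>. approx (s i) \<phi>" for i
  proof (rule indicator_open_approx[OF s_open[of i]])
    fix \<phi> :: "nat \<Rightarrow> 'g \<Rightarrow> real"
    assume "\<And>m. continuous_on UNIV (\<phi> m)"
      "\<And>m g. 0 \<le> \<phi> m g" "\<And>m g. \<phi> m g \<le> 1" "\<And>m g. g \<notin> s i \<Longrightarrow> \<phi> m g = 0"
      "\<And>g. g \<in> s i \<Longrightarrow> \<forall>\<^sub>F m in sequentially. \<phi> m g = 1"
    then have "approx (s i) \<phi>" by (simp add: approx_def)
    then show "\<exists>\<phi>. approx (s i) \<phi>" by (rule exI[of _ \<phi>])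
  qed
  then obtain \<phi> where ap: "\<And>i. approx (s i) (\<phi> i)" by metis
  have \<phi>: "continuous_on UNIV (\<phi> i m)" "0 \<le> \<phi> i m g" "\<phi> i m g \<le> 1"
    "g \<notin> s i \<Longrightarrow> \<phi> i m g = 0" for i m g using ap[of i] by (auto simp: approx_def)
  have \<phi>_lim: "\<forall>\<^sub>F m in sequentially. \<phi> i m g = 1" if "g \<in> s i" for i g
    using ap[of i] that by (auto simp: approx_def)
  have "U0 \<in> range s" using U0(1) s by simp
  then obtain i0 where "U0 = s i0" by (rule rangeE)
  then have "\<exists>m. \<phi> i0 m 0 = 1"
    using U0(2) by (intro eventually_happens'[OF sequentially_bot] \<phi>_lim) simp
  then obtain m0 where m0: "\<phi> i0 m0 0 = 1" ..
  define v where "v n = \<phi> (fst (prod_decode n)) (snd (prod_decode n))" for n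
  (* The function at index 0 has to be nonzero: it later forces a maximum to be positive. *)
  define u where "u n = (case n of 0 \<Rightarrow> \<phi> i0 m0 | Suc n \<Rightarrow> v n)" for n
  have u: "\<exists>i m. u n = \<phi> i m" for n by (cases n) (auto simp: u_def v_def)
  have \<phi>u: "\<exists>n. \<phi> i m = u n" for i m
    by (intro exI[of _ "Suc (prod_encode (i, m))"]) (simp add: u_def v_def)
  show ?thesis
  proof (rule that[of u])
    fix n
    obtain i m where un: "u n = \<phi> i m" using u by blast
    show "continuous_on UNIV (u n)" "0 \<le> u n g" "u n g \<le> 1" for g unfolding un by (rule \<phi>)+
    have "s i \<in> S" using s by blast
    then obtain C where C: "compact C" "s i \<subseteq> C" using S_cpt by blast
    have "u n g = 0" if "g \<notin> C" for g unfolding un using \<phi>(4) C(2) that by blast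
    then show "\<exists>C. compact C \<and> (\<forall>g. g \<notin> C \<longrightarrow> u n g = 0)" using C(1) by blast
  next
    show "\<exists>g. 0 < u 0 g" using m0 by (intro exI[of _ 0]) (simp add: u_def)
  next
    fix q q' :: "'g measure"
    assume fin: "finite_measure q" "finite_measure q'" and sq: "sets q = sets borel" "sets q' = sets borel"
      and eq: "\<And>i. (\<integral>\<^sup>+ g. ennreal (u i g) \<partial>q) = (\<integral>\<^sup>+ g. ennreal (u i g) \<partial>q')"
    have lim: "(\<lambda>m. \<integral>\<^sup>+ g. ennreal (\<phi> i m g) \<partial>r) \<longlonglongrightarrow> emeasure r (s i)"
      if r: "finite_measure r" "sets r = sets borel" for i r
    proof -
      have "(\<lambda>m. \<integral>\<^sup>+ g. ennreal (\<phi> i m g) \<partial>r) \<longlonglongrightarrow> (\<integral>\<^sup>+ g. indicator (s i) g \<partial>r)"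
      proof (rule nn_integral_dominated_convergence[where w = "\<lambda>_. 1"])
        show "(\<lambda>g. ennreal (\<phi> i m g)) \<in> borel_measurable r" for m
        proof -
          have "\<phi> i m \<in> borel_measurable r"
            unfolding measurable_cong_sets[OF r(2) refl] by (rule borel_measurable_continuous_onI[OF \<phi>(1)])
          then show ?thesis by measurable
        qed
        show "(\<lambda>g. indicator (s i) g :: ennreal) \<in> borel_measurable r"
          using s_open[of i] r(2) by (intro borel_measurable_indicator) auto
        show "(\<integral>\<^sup>+ g. 1 \<partial>r) < \<infinity>" using finite_measure.emeasure_finite[OF r(1), of "space r"] by (simp add: less_top[symmetric])
        show "AE g in r. ennreal (\<phi> i m g) \<le> 1" for m using \<phi>(3) by simp
        have "(\<lambda>m. ennreal (\<phi> i m g)) \<longlonglongrightarrow> indicator (s i) g" for g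
        proof (cases "g \<in> s i")
          case True
          then have "\<forall>\<^sub>F m in sequentially. ennreal (\<phi> i m g) = indicator (s i) g"
            using \<phi>_lim[OF True] by (auto elim: eventually_mono)
          then show ?thesis by (rule tendsto_eventually)
        qed (simp add: \<phi>(4))
        then show "AE g in r. (\<lambda>m. ennreal (\<phi> i m g)) \<longlonglongrightarrow> indicator (s i) g" by simp
      qed simp
      then show ?thesis using s_open[of i] r(2) by simp
    qed
    have eqS: "emeasure q U = emeasure q' U" if US: "U \<in> S" for U
    proof -
      have "U \<in> range s" using US s by simp
      then obtain i where i: "U = s i" by (rule rangeE)
      have "(\<integral>\<^sup>+ g. ennreal (\<phi> i m g) \<partial>q) = (\<integral>\<^sup>+ g. ennreal (\<phi> i m g) \<partial>q')" for m
        using \<phi>u[of i m] eq by metis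
      then show ?thesis using lim[OF fin(1) sq(1), of i] lim[OF fin(2) sq(2), of i] unfolding i
        by (auto intro: LIMSEQ_unique)
    qed
    show "q = q'"
    proof (rule measure_eqI_generator_eq_countable[where A = S and \<Omega> = UNIV and E = S])
      show "\<Union> S = UNIV"
      proof (intro equalityI subsetI)
        fix x :: 'g
        obtain U where "U \<in> R" "x \<in> U" using R_basis[OF open_UNIV, of x] by blast
        then show "x \<in> \<Union> S" using RS by blast
      qed simp
    qed (use S_Int eqS sq S_borel cS fin in \<open>auto simp: finite_measure.emeasure_finite\<close>)
  qed
qed

lemma translate_integral_continuous:
  fixes u :: "'g \<Rightarrow> real"
  assumes "finite_measure q" and sq: "sets q = sets borel"
    and u: "continuous_on UNIV u" "\<And>g. 0 \<le> u g" "\<And>g. u g \<le> 1"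
  shows "continuous_on UNIV (\<lambda>h. \<integral>g. u (g - h) \<partial>q)"
proof -
  interpret q: finite_measure q by fact
  have meas: "(\<lambda>g. u (g - h)) \<in> borel_measurable q" for h
  proof -
    have "(\<lambda>g. u (g - h)) \<in> borel_measurable borel"
      by (intro borel_measurable_continuous_onI continuous_on_compose2[OF u(1)] continuous_intros) auto
    then show ?thesis using measurable_cong_sets[OF sq refl] by blast
  qed
  have "((\<lambda>h. \<integral>g. u (g - h) \<partial>q) \<longlongrightarrow> (\<integral>g. u (g - h) \<partial>q)) (at h)" for h
    unfolding tendsto_at_iff_sequentially o_def
  proof (intro allI impI)
    fix X :: "nat \<Rightarrow> 'g" assume X: "X \<longlonglongrightarrow> h"
    show "(\<lambda>i. \<integral>g. u (g - X i) \<partial>q) \<longlonglongrightarrow> (\<integral>g. u (g - h) \<partial>q)"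
    proof (rule integral_dominated_convergence[where w = "\<lambda>_. 1"])
      have "(\<lambda>i. u (g - X i)) \<longlonglongrightarrow> u (g - h)" for g
        by (rule continuous_on_tendsto_compose[OF u(1)]) (auto intro!: tendsto_intros X)
      then show "AE g in q. (\<lambda>i. u (g - X i)) \<longlonglongrightarrow> u (g - h)" by simp
      show "AE g in q. norm (u (g - X i)) \<le> 1" for i using u by simp
    qed (use meas in auto)
  qed
  then show ?thesis by (simp add: continuous_on_def)
qed

lemma translate_integral_vanishes:
  fixes u :: "'g \<Rightarrow> real"
  assumes "finite_measure q" and sq: "sets q = sets borel"
    and u: "continuous_on UNIV u" "\<And>g. 0 \<le> u g" "\<And>g. u g \<le> 1"
    and C: "compact C" "\<And>g. g \<notin> C \<Longrightarrow> u g = 0" and "e > 0"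
  shows "\<exists>K. compact K \<and> (\<forall>h. h \<notin> K \<longrightarrow> (\<integral>g. u (g - h) \<partial>q) < e)"
proof -
  interpret q: finite_measure q by fact
  have [simp]: "space q = UNIV" using sets_eq_imp_space_eq[OF sq] by simp
  obtain K :: "nat \<Rightarrow> 'g set" where K: "\<And>n. compact (K n)" "incseq K" "(\<Union>n. K n) = UNIV"
    using compact_exhaustion by metis
  have Kq: "K n \<in> sets q" for n using K(1) sq borel_compact by blast
  have "(\<lambda>n. measure q (K n)) \<longlonglongrightarrow> measure q (\<Union>n. K n)"
    using Kq K(2) by (intro q.finite_Lim_measure_incseq) auto
  then have "\<forall>\<^sub>F n in sequentially. measure q UNIV - e < measure q (K n)"
    using \<open>e > 0\<close> by (intro order_tendstoD(1)) (auto simp: K(3))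
  then have "\<exists>n. measure q UNIV - e < measure q (K n)" by (rule eventually_happens'[OF sequentially_bot])
  then obtain n where n: "measure q UNIV - e < measure q (K n)" ..
  let ?K = "(\<lambda>(c, g). - c + g) ` (C \<times> K n)"
  have "compact ?K"
    using C(1) K(1)[of n] by (intro compact_continuous_image compact_Times)
      (auto simp: split_beta intro!: continuous_intros)
  moreover have "(\<integral>g. u (g - h) \<partial>q) < e" if "h \<notin> ?K" for h
  proof -
    have "u (g - h) \<le> indicator (UNIV - K n) g" for g
    proof (cases "g \<in> K n")
      case True
      have "g - h \<notin> C"
      proof
        assume "g - h \<in> C"
        then have "h \<in> ?K" using True by (intro image_eqI[of _ _ "(g - h, g)"]) (auto simp: minus_diff_eq)
        then show False using that by simp
      qed
      then show ?thesis using True C(2) by simp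
    qed (use u in simp)
    moreover have "integrable q (indicat_real (UNIV - K n))"
      using Kq[of n] sq by (intro integrable_real_indicator) (auto simp: q.emeasure_finite less_top[symmetric])
    ultimately have "(\<integral>g. u (g - h) \<partial>q) \<le> (\<integral>g. indicator (UNIV - K n) g \<partial>q)"
      by (intro integral_mono') (auto simp: u)
    also have "\<dots> = measure q UNIV - measure q (K n)"
      using Kq[of n] q.finite_measure_compl[of "K n"] by simp
    also have "\<dots> < e" using n by simp
    finally show ?thesis .
  qed
  ultimately show ?thesis by blast
qed

end

section \<open>Mass transport and transversals\<close>

locale nonsingular_action = lcsc_haar L
  for L :: "'g::{topological_group_add, second_countable_topology, t2_space} measure" +
  fixes act :: "'g \<Rightarrow> 'x \<Rightarrow> 'x" and M :: "'x measure" and rn :: "'g \<Rightarrow> 'x \<Rightarrow> real"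
  assumes nonsingular: "nonsingular_G_space act M"
    and cocycle: "radon_nikodym_cocycle act M rn"
begin

lemma act_measurable: "(\<lambda>(g, x). act g x) \<in> borel \<Otimes>\<^sub>M M \<rightarrow>\<^sub>M M"
  and act_zero: "x \<in> space M \<Longrightarrow> act 0 x = x"
  and act_add: "x \<in> space M \<Longrightarrow> act (g + h) x = act g (act h x)"
  and standard: "standard_borel_space M"
  using nonsingular by (auto simp: nonsingular_G_space_def borel_G_space_def)

lemma rn_measurable: "(\<lambda>(g, x). rn g x) \<in> borel_measurable (borel \<Otimes>\<^sub>M M)"
  and rn_pos: "x \<in> space M \<Longrightarrow> rn g x > 0"
  and rn_add: "x \<in> space M \<Longrightarrow> rn (g + h) x = rn g (act h x) * rn h x"
  and rn_RN_deriv: "AE x in M. ennreal (rn g x) = RN_deriv M (translate_measure act M g) x"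
  using cocycle by (auto simp: radon_nikodym_cocycle_def)

sublocale M: sigma_finite_measure M
  using nonsingular by (simp add: nonsingular_G_space_def)

lemma measurable_act [measurable (raw)]:
  assumes "f \<in> borel_measurable N" "k \<in> N \<rightarrow>\<^sub>M M"
  shows "(\<lambda>z. act (f z) (k z)) \<in> N \<rightarrow>\<^sub>M M"
proof -
  have "(\<lambda>z. (f z, k z)) \<in> N \<rightarrow>\<^sub>M borel \<Otimes>\<^sub>M M" using assms by measurable
  from measurable_compose[OF this act_measurable] show ?thesis by simp
qed

lemma measurable_rn [measurable (raw)]:
  assumes "f \<in> borel_measurable N" "k \<in> N \<rightarrow>\<^sub>M M"
  shows "(\<lambda>z. rn (f z) (k z)) \<in> borel_measurable N"
proof -
  have "(\<lambda>z. (f z, k z)) \<in> N \<rightarrow>\<^sub>M borel \<Otimes>\<^sub>M M" using assms by measurable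
  from measurable_compose[OF this rn_measurable] show ?thesis by simp
qed

lemma act_space: "x \<in> space M \<Longrightarrow> act g x \<in> space M"
  using measurable_space[OF measurable_act[of "\<lambda>_. g" M "\<lambda>x. x"], of x] by simp

lemma act_minus: "x \<in> space M \<Longrightarrow> act (- g) (act g x) = x" "x \<in> space M \<Longrightarrow> act g (act (- g) x) = x"
  by (simp_all add: act_add[symmetric] act_zero)

lemma G_invariantI:
  assumes "A \<subseteq> space M" "\<And>g x. x \<in> A \<Longrightarrow> act g x \<in> A"
  shows "G_invariant act A"
  unfolding G_invariant_def
proof (intro allI equalityI subsetI)
  fix g x assume x: "x \<in> A"
  show "x \<in> act g ` A"
    using x assms by (intro image_eqI[of _ _ "act (- g) x"]) (auto simp: act_minus)
qed (use assms in auto)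

text \<open>
  The cocycle is the density of the translated measure; this is the change of variables $x \mapsto g^{-1}.x$.
\<close>

lemma nn_integral_rn:
  assumes [measurable]: "k \<in> borel_measurable M"
  shows "(\<integral>\<^sup>+ x. ennreal (rn g x) * k x \<partial>M) = (\<integral>\<^sup>+ x. k (act (- g) x) \<partial>M)"
proof -
  have [simp]: "sets (translate_measure act M g) = sets M" by (simp add: translate_measure_def)
  have "(\<integral>\<^sup>+ x. ennreal (rn g x) * k x \<partial>M) = (\<integral>\<^sup>+ x. RN_deriv M (translate_measure act M g) x * k x \<partial>M)"
    using rn_RN_deriv[of g] by (intro nn_integral_cong_AE) auto
  also have "\<dots> = (\<integral>\<^sup>+ x. k x \<partial>density M (RN_deriv M (translate_measure act M g)))"
    by (simp add: nn_integral_density)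
  also have "density M (RN_deriv M (translate_measure act M g)) = translate_measure act M g"
    using nonsingular by (intro M.density_RN_deriv) (auto simp: nonsingular_G_space_def)
  also have "(\<integral>\<^sup>+ x. k x \<partial>translate_measure act M g) = (\<integral>\<^sup>+ x. k (act (- g) x) \<partial>M)"
    unfolding translate_measure_def by (subst nn_integral_distr) auto
  finally show ?thesis .
qed

lemma mass_transport:
  assumes [measurable]: "F \<in> borel_measurable M" "H \<in> borel_measurable M"
  shows "(\<integral>\<^sup>+ x. (\<integral>\<^sup>+ g. ennreal (rn g x) * F (act g x) \<partial>L) * H x \<partial>M) =
    (\<integral>\<^sup>+ x. F x * (\<integral>\<^sup>+ g. H (act (- g) x) \<partial>L) \<partial>M)"
proof -
  interpret P: pair_sigma_finite L M ..
  have "(\<integral>\<^sup>+ x. (\<integral>\<^sup>+ g. ennreal (rn g x) * F (act g x) \<partial>L) * H x \<partial>M) =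
    (\<integral>\<^sup>+ x. (\<integral>\<^sup>+ g. ennreal (rn g x) * F (act g x) * H x \<partial>L) \<partial>M)"
    by (intro nn_integral_cong nn_integral_multc[symmetric]) measurable
  also have "\<dots> = (\<integral>\<^sup>+ g. (\<integral>\<^sup>+ x. ennreal (rn g x) * F (act g x) * H x \<partial>M) \<partial>L)"
    by (rule P.Fubini') measurable
  also have "\<dots> = (\<integral>\<^sup>+ g. (\<integral>\<^sup>+ x. F x * H (act (- g) x) \<partial>M) \<partial>L)"
  proof (rule nn_integral_cong)
    fix g
    have "(\<integral>\<^sup>+ x. ennreal (rn g x) * F (act g x) * H x \<partial>M) = (\<integral>\<^sup>+ x. F (act g (act (- g) x)) * H (act (- g) x) \<partial>M)"
      using nn_integral_rn[of "\<lambda>x. F (act g x) * H x" g] by (simp add: mult.assoc)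
    also have "\<dots> = (\<integral>\<^sup>+ x. F x * H (act (- g) x) \<partial>M)"
      by (rule nn_integral_cong) (simp add: act_minus)
    finally show "(\<integral>\<^sup>+ x. ennreal (rn g x) * F (act g x) * H x \<partial>M) = (\<integral>\<^sup>+ x. F x * H (act (- g) x) \<partial>M)" .
  qed
  also have "\<dots> = (\<integral>\<^sup>+ x. (\<integral>\<^sup>+ g. F x * H (act (- g) x) \<partial>L) \<partial>M)"
    by (rule P.Fubini'[symmetric]) measurable
  also have "\<dots> = (\<integral>\<^sup>+ x. F x * (\<integral>\<^sup>+ g. H (act (- g) x) \<partial>L) \<partial>M)"
    by (intro nn_integral_cong nn_integral_cmult) measurable
  finally show ?thesis .
qed

lemma orbit_integral_measurable [measurable]:
  assumes "f \<in> L1_plus M"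
  shows "orbit_integral L act rn f \<in> borel_measurable M"
proof -
  have [measurable]: "f \<in> borel_measurable M" using assms by (auto simp: L1_plus_def)
  show ?thesis unfolding orbit_integral_def by measurable
qed

text \<open>
  The function $\theta(x) = \lambda\{g : g^{-1}.x \in C\}$ is $G$-invariant. Mass transport with the
  indicator of $C \cap \{\theta \le m\}$ therefore bounds the integral of $S_f$ over this set by $m \int f\,d\mu$.
\<close>

lemma orbit_integral_finite_on:
  assumes f: "f \<in> L1_plus M" and C [measurable]: "C \<in> sets M"
    and fin: "\<And>x. x \<in> C \<Longrightarrow> (\<integral>\<^sup>+ g. indicator C (act (- g) x) \<partial>L) < \<infinity>"
  shows "AE x in M. x \<in> C \<longrightarrow> orbit_integral L act rn f x < \<infinity>"
proof -
  note [measurable] = orbit_integral_measurable[OF f]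
  have [measurable]: "f \<in> borel_measurable M" and f_pos: "\<And>x. x \<in> space M \<Longrightarrow> f x > 0"
    and f_int: "(\<integral>\<^sup>+ x. ennreal (f x) \<partial>M) < \<infinity>"
  proof -
    show "f \<in> borel_measurable M" "\<And>x. x \<in> space M \<Longrightarrow> f x > 0" using f by (auto simp: L1_plus_def)
    have "(\<integral>\<^sup>+ x. ennreal (f x) \<partial>M) \<le> (\<integral>\<^sup>+ x. ennreal (norm (f x)) \<partial>M)"
      by (intro nn_integral_mono ennreal_leI) simp
    also have "\<dots> < \<infinity>" using f by (simp add: L1_plus_def integrable_iff_bounded)
    finally show "(\<integral>\<^sup>+ x. ennreal (f x) \<partial>M) < \<infinity>" .
  qed
  define \<theta> where "\<theta> x = (\<integral>\<^sup>+ g. indicator C (act (- g) x) \<partial>L :: ennreal)" for x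
  have [measurable]: "\<theta> \<in> borel_measurable M" unfolding \<theta>_def by measurable
  have \<theta>_inv: "\<theta> (act h x) = \<theta> x" if x: "x \<in> space M" for h x
  proof -
    have "\<theta> (act h x) = (\<integral>\<^sup>+ g. indicator C (act (- (- h + g)) x) \<partial>L)"
      unfolding \<theta>_def by (simp add: minus_add act_add[OF x, symmetric])
    also have "\<dots> = \<theta> x"
      unfolding \<theta>_def using x by (subst nn_integral_left_translate[of "\<lambda>g. indicator C (act (- g) x)"]) measurable
    finally show ?thesis .
  qed
  define H where "H m x = (indicator (C \<inter> {x\<in>space M. \<theta> x \<le> of_nat m}) x :: ennreal)" for m :: nat and x
  have H_meas [measurable]: "H m \<in> borel_measurable M" for m unfolding H_def by measurable
  have H_bound: "(\<integral>\<^sup>+ g. H m (act (- g) x) \<partial>L) \<le> of_nat m" if x: "x \<in> space M" for m x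
  proof (cases "\<theta> x \<le> of_nat m")
    case True
    have "(\<integral>\<^sup>+ g. H m (act (- g) x) \<partial>L) \<le> \<theta> x"
      unfolding \<theta>_def H_def by (intro nn_integral_mono) (auto simp: indicator_def)
    then show ?thesis using True by simp
  next
    case False
    have "H m (act (- g) x) = 0" for g using False x by (simp add: H_def \<theta>_inv)
    then show ?thesis by simp
  qed
  have S_eq: "orbit_integral L act rn f x = (\<integral>\<^sup>+ g. ennreal (rn g x) * ennreal (f (act g x)) \<partial>L)"
    if "x \<in> space M" for x
    unfolding orbit_integral_def using that
    by (intro nn_integral_cong ennreal_mult) (auto intro: less_imp_le rn_pos f_pos act_space)
  have "AE x in M. orbit_integral L act rn f x * H m x \<noteq> \<infinity>" for m
  proof (rule nn_integral_noteq_infinite)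
    have "(\<integral>\<^sup>+ x. orbit_integral L act rn f x * H m x \<partial>M) =
        (\<integral>\<^sup>+ x. (\<integral>\<^sup>+ g. ennreal (rn g x) * ennreal (f (act g x)) \<partial>L) * H m x \<partial>M)"
      by (intro nn_integral_cong) (simp add: S_eq)
    also have "\<dots> = (\<integral>\<^sup>+ x. ennreal (f x) * (\<integral>\<^sup>+ g. H m (act (- g) x) \<partial>L) \<partial>M)"
      by (rule mass_transport) measurable
    also have "\<dots> \<le> (\<integral>\<^sup>+ x. ennreal (f x) * of_nat m \<partial>M)"
      by (intro nn_integral_mono mult_left_mono H_bound) auto
    also have "\<dots> = (\<integral>\<^sup>+ x. ennreal (f x) \<partial>M) * of_nat m" by (rule nn_integral_multc) measurable
    also have "\<dots> < \<infinity>" using f_int by (simp add: ennreal_mult_less_top of_nat_less_top)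
    finally show "(\<integral>\<^sup>+ x. orbit_integral L act rn f x * H m x \<partial>M) \<noteq> \<infinity>" by simp
  qed measurable
  then have "AE x in M. \<forall>m. orbit_integral L act rn f x * H m x \<noteq> \<infinity>" by (simp add: AE_all_countable)
  then show ?thesis
  proof (rule AE_mp, intro AE_I2 impI)
    fix x assume x: "x \<in> space M" "\<forall>m. orbit_integral L act rn f x * H m x \<noteq> \<infinity>" "x \<in> C"
    obtain m where "\<theta> x < of_nat m" using fin[OF x(3)] ennreal_Ex_less_of_nat unfolding \<theta>_def by auto
    then have "H m x = 1" using x by (simp add: H_def less_imp_le)
    then show "orbit_integral L act rn f x < \<infinity>" using x(2)[rule_format, of m] by (simp add: less_top)
  qed
qed

text \<open>
  For $K$ compact, consider the points of $K.W$. If $x = h.w$ with $w \in W$, then $g^{-1}.x \in K.W$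
  forces $g \in h\,G_w K^{-1}$, since $W$ meets the orbit only in $w$. This set is compact, and
  lemma \<open>orbit_integral_finite_on\<close> applies to every measurable subset of $K.W$. By lemma \<open>measurable_projection\<close>
  they exhaust $X'$ in measure.
\<close>

lemma orbit_integral_finite_of_transversal:
  assumes f: "f \<in> L1_plus M"
    and X': "X' \<in> sets M" "space M - X' \<in> null_sets M" and inv: "\<And>g x. x \<in> X' \<Longrightarrow> act g x \<in> X'"
    and W: "W \<in> sets M" "W \<subseteq> X'"
    and W_ex: "\<And>x. x \<in> X' \<Longrightarrow> \<exists>g. act g x \<in> W"
    and W_uniq: "\<And>x g. x \<in> W \<Longrightarrow> act g x \<in> W \<Longrightarrow> act g x = x"
    and stab: "\<And>x. x \<in> X' \<Longrightarrow> compact (stabilizer act x)"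
  shows "AE x in M. orbit_integral L act rn f x < \<infinity>"
proof -
  have X'_space: "X' \<subseteq> space M" using X'(1) by (rule sets.sets_into_space)
  obtain p :: "'x \<Rightarrow> real" where p: "p \<in> borel_measurable M" "\<And>x. p x > 0" "integrable M p"
    using M.obtain_positive_integrable_function by metis
  note [measurable] = p(1) orbit_integral_measurable[OF f] W(1) X'(1)
  (* Outer measure and projections are handled for a finite measure with the same null sets as M. *)
  define N where "N = density M (\<lambda>x. ennreal (p x))"
  have N_sets [measurable_cong]: "sets N = sets M" and N_space: "space N = space M" by (simp_all add: N_def)
  have N_AE: "(AE x in N. P x) \<longleftrightarrow> (AE x in M. P x)" for P
    unfolding N_def using p by (simp add: AE_density)
  interpret N: finite_measure N
  proof
    have "emeasure N (space N) = (\<integral>\<^sup>+ x. ennreal (p x) \<partial>M)"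
      unfolding N_def by (simp add: emeasure_density cong: nn_integral_cong)
    also have "\<dots> < \<infinity>"
      using p(2,3) by (simp add: integrable_iff_bounded less_imp_le)
    finally show "emeasure N (space N) \<noteq> \<infinity>" by simp
  qed
  obtain K :: "nat \<Rightarrow> 'g set" where K: "\<And>n. compact (K n)" "incseq K" "(\<Union>n. K n) = UNIV"
    using compact_exhaustion by metis
  define B where "B = {z \<in> space (borel \<Otimes>\<^sub>M N). act (- fst z) (snd z) \<in> W}"
  have B: "B \<in> sets (borel \<Otimes>\<^sub>M N)" unfolding B_def by measurable
  define S where "S n = {x\<in>space N. \<exists>g\<in>K n. (g, x) \<in> B}" for n
  have S_iff: "x \<in> S n \<longleftrightarrow> x \<in> space M \<and> (\<exists>g\<in>K n. act (- g) x \<in> W)" for x n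
    by (auto simp: S_def B_def space_pair_measure N_space)
  have "(\<Union>n. S n) = X'"
  proof (intro equalityI subsetI)
    fix x assume "x \<in> (\<Union>n. S n)"
    then obtain g where "x \<in> space M" "act (- g) x \<in> W" by (auto simp: S_iff)
    then show "x \<in> X'" using inv[of "act (- g) x" g] W(2) by (auto simp: act_minus)
  next
    fix x assume x: "x \<in> X'"
    then obtain g where g: "act g x \<in> W" using W_ex by blast
    have "- g \<in> (\<Union>n. K n)" using K(3) by simp
    then obtain n where "- g \<in> K n" by blast
    then have "x \<in> S n" using g x X'_space by (auto simp: S_iff intro!: bexI[of _ "- g"])
    then show "x \<in> (\<Union>n. S n)" by blast
  qed
  moreover have "incseq S" using K(2) unfolding incseq_def S_def by blast
  ultimately have outer: "(SUP n. outer_measure_of N (S n)) = emeasure N X'"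
    using SUP_outer_measure_of_incseq[of S N] X'(1) by (auto simp: S_def N_sets)
  define E where "E = {x\<in>space M. orbit_integral L act rn f x < \<infinity>}"
  have E: "E \<in> sets N" unfolding E_def N_sets by measurable
  have "emeasure N X' \<le> emeasure N E"
  proof (rule dense_le)
    fix c assume "c < emeasure N X'"
    then obtain n where n: "c < outer_measure_of N (S n)" unfolding outer[symmetric] less_SUP_iff by blast
    have "\<exists>C\<in>sets N. C \<subseteq> S n \<and> c \<le> emeasure N C"
      unfolding S_def
      by (rule measurable_projection[OF open_Fsigma B N.finite_measure_axioms K(1) n[unfolded S_def]])
    then obtain C where C: "C \<in> sets N" "C \<subseteq> S n" "c \<le> emeasure N C" by blast
    have "AE x in M. x \<in> C \<longrightarrow> orbit_integral L act rn f x < \<infinity>"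
    proof (rule orbit_integral_finite_on[OF f])
      show CM: "C \<in> sets M" using C(1) N_sets by simp
      fix x assume "x \<in> C"
      then obtain h where x: "x \<in> space M" and h: "act (- h) x \<in> W" using C(2) S_iff by blast
      define w where "w = act (- h) x"
      have w: "w \<in> W" "w \<in> space M" "x = act h w" using h x by (auto simp: w_def act_space act_minus)
      let ?Q = "(\<lambda>(s, k). h + s - k) ` (stabilizer act w \<times> K n)"
      have cQ: "compact ?Q"
        using stab[of w] w(1) W(2) K(1)
        by (intro compact_continuous_image compact_Times) (auto simp: split_beta intro!: continuous_intros)
      have sub: "g \<in> ?Q" if sub_g: "act (- g) x \<in> C" for g
      proof -
        obtain k where k: "k \<in> K n" "act (- k) (act (- g) x) \<in> W" using sub_g C(2) S_iff by blast
        define s where "s = - h + (g + k)"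
        have "act (- s) w = act (- k) (act (- g) x)"
          using w by (simp add: s_def minus_add act_add[symmetric] add.assoc del: add_uminus_conv_diff)
        then have "act (- s) w = w" using W_uniq[of w "- s"] w(1) k(2) by simp
        then have "act s w = w" using act_minus(2)[OF w(2), of s] by simp
        then have "s \<in> stabilizer act w" by (simp add: stabilizer_def)
        moreover have "g = h + s - k" by (simp add: s_def add.assoc[symmetric])
        ultimately show ?thesis using k(1) by (intro image_eqI[of _ _ "(s, k)"]) auto
      qed
      have "(\<integral>\<^sup>+ g. indicator C (act (- g) x) \<partial>L) \<le> (\<integral>\<^sup>+ g. indicator ?Q g \<partial>L)"
        using sub by (intro nn_integral_mono) (auto simp: indicator_def)
      also have "\<dots> = emeasure L ?Q" using borel_compact[OF cQ] by simp
      also have "\<dots> < \<infinity>" using finite_on_compact[OF cQ] .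
      finally show "(\<integral>\<^sup>+ g. indicator C (act (- g) x) \<partial>L) < \<infinity>" .
    qed
    then have "AE x in N. x \<in> C \<longrightarrow> x \<in> E"
      unfolding N_AE by (rule AE_mp) (auto simp: E_def)
    then have "emeasure N C \<le> emeasure N E" using E by (intro emeasure_mono_AE)
    with C(3) show "c \<le> emeasure N E" by (rule order_trans)
  qed
  moreover have "emeasure N X' = emeasure N (space N)"
  proof (rule emeasure_eq_AE)
    have "AE x in M. x \<in> X'" using X'(2) by (intro AE_I'[of "space M - X'"]) auto
    then show "AE x in N. x \<in> X' \<longleftrightarrow> x \<in> space N"
      unfolding N_AE by (rule AE_mp) (auto simp: N_space)
  qed (use X'(1) sets.top[of N] in \<open>auto simp: N_sets\<close>)
  ultimately have "emeasure N (space N - E) = 0"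
    using E N.emeasure_eq_measure N.finite_measure_compl[OF E] by (simp add: ennreal_eq_0_iff)
  then have "AE x in N. x \<in> E" using E by (intro AE_I'[of "space N - E"]) auto
  then show ?thesis unfolding N_AE by (rule AE_mp) (auto simp: E_def)
qed

end

section \<open>Measures along the orbits of the dissipative part\<close>

context nonsingular_action begin

text \<open>
  The whole space comes first so that one of the restricted orbit measures is the unrestricted one.
\<close>

lemma separating_sets:
  obtains U :: "nat \<Rightarrow> 'x set" where "\<And>n. U n \<in> sets M" "U 0 = space M"
    "\<And>x y. x \<in> space M \<Longrightarrow> y \<in> space M \<Longrightarrow> (\<And>n. x \<in> U n \<longleftrightarrow> y \<in> U n) \<Longrightarrow> x = y"
proof -
  obtain T where T: "completely_metrizable_space T" "second_countable T" "topspace T = space M"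
    "sets M = sigma_sets (space M) {U. openin T U}"
    using standard unfolding standard_borel_space_def by blast
  then obtain \<B> where \<B>: "countable \<B>" "\<And>V. V \<in> \<B> \<Longrightarrow> openin T V"
    "\<And>V x. openin T V \<Longrightarrow> x \<in> V \<Longrightarrow> \<exists>B\<in>\<B>. x \<in> B \<and> B \<subseteq> V"
    unfolding second_countable_def by metis
  have H: "Hausdorff_space T"
    using T(1) by (intro metrizable_imp_Hausdorff_space completely_metrizable_imp_metrizable_space)
  define U where "U n = (case n of 0 \<Rightarrow> space M | Suc n \<Rightarrow> from_nat_into (insert {} \<B>) n)" for n
  have ran: "range (from_nat_into (insert {} \<B>)) = insert {} \<B>"
    using \<B>(1) by (intro range_from_nat_into) auto
  show ?thesis
  proof (rule that[of U])
    show "U 0 = space M" by (simp add: U_def)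
    show "U n \<in> sets M" for n
    proof (cases n)
      case (Suc k)
      have "from_nat_into (insert {} \<B>) k \<in> insert {} \<B>" using ran by blast
      then have "openin T (U n)" using \<B>(2) Suc by (auto simp: U_def)
      then show ?thesis unfolding T(4) by (intro sigma_sets.Basic) simp
    qed (simp add: U_def)
    fix x y assume xy: "x \<in> space M" "y \<in> space M" and eq: "\<And>n. x \<in> U n \<longleftrightarrow> y \<in> U n"
    show "x = y"
    proof (rule ccontr)
      assume "x \<noteq> y"
      then obtain V V' where V: "openin T V" "openin T V'" "x \<in> V" "y \<in> V'" "disjnt V V'"
        using H xy unfolding Hausdorff_space_def T(3) by metis
      then obtain B where B: "B \<in> \<B>" "x \<in> B" "B \<subseteq> V" using \<B>(3) by metis
      then have "B \<in> range (from_nat_into (insert {} \<B>))" unfolding ran by simp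
      then obtain n where "B = from_nat_into (insert {} \<B>) n" by (rule rangeE)
      then have "B = U (Suc n)" by (simp add: U_def)
      then have "y \<in> B" using eq B(2) by simp
      then show False using B(3) V(4,5) by (auto simp: disjnt_def)
    qed
  qed
qed

context
  fixes f assumes f: "f \<in> L1_plus M"
begin

lemma f_pos: "x \<in> space M \<Longrightarrow> f x > 0" and f_measurable [measurable]: "f \<in> borel_measurable M"
  using f by (auto simp: L1_plus_def)

lemmas S_measurable [measurable] = orbit_integral_measurable[OF f]

text \<open>
  By the cocycle identity the integrand of the left-hand side at $g$ is, up to the factor $1/\nabla_h(x)$, that of
  $S_f(x)$ at $gh$. The constant $c$ comes from right translation of the Haar measure.
\<close>

lemma orbit_integral_act:
  assumes x: "x \<in> space M"
    and c: "0 < c" "c < \<infinity>"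
      "\<And>F. F \<in> borel_measurable borel \<Longrightarrow> (\<integral>\<^sup>+ g. F (g + h) \<partial>L) = c * (\<integral>\<^sup>+ g. F g \<partial>L)"
  shows "orbit_integral L act rn f (act h x) = ennreal (1 / rn h x) * (c * orbit_integral L act rn f x)"
proof -
  have pos: "0 < rn h x" using x by (rule rn_pos)
  have "orbit_integral L act rn f (act h x) =
      (\<integral>\<^sup>+ g. ennreal (1 / rn h x) * ennreal (rn (g + h) x * f (act (g + h) x)) \<partial>L)"
    unfolding orbit_integral_def
    using pos by (intro nn_integral_cong) (simp add: rn_add[OF x] act_add[OF x] ennreal_mult'[symmetric])
  also have "\<dots> = ennreal (1 / rn h x) * (\<integral>\<^sup>+ g. ennreal (rn (g + h) x * f (act (g + h) x)) \<partial>L)"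
    using x by (intro nn_integral_cmult) measurable
  also have "(\<integral>\<^sup>+ g. ennreal (rn (g + h) x * f (act (g + h) x)) \<partial>L) = c * orbit_integral L act rn f x"
    unfolding orbit_integral_def using x by (intro c(3)) measurable
  finally show ?thesis .
qed

lemma orbit_integral_act_finite_iff:
  assumes x: "x \<in> space M"
  shows "orbit_integral L act rn f (act h x) < \<infinity> \<longleftrightarrow> orbit_integral L act rn f x < \<infinity>"
proof -
  obtain c where c: "0 < c" "c < \<infinity>"
      "\<And>F. F \<in> borel_measurable borel \<Longrightarrow> (\<integral>\<^sup>+ g. F (g + h) \<partial>L) = c * (\<integral>\<^sup>+ g. F g \<partial>L)"
    using nn_integral_right_translate by metis
  have "orbit_integral L act rn f (act h x) = ennreal (1 / rn h x) * (c * orbit_integral L act rn f x)"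
    by (rule orbit_integral_act[OF x c(1,2)]) (rule c(3))
  then show ?thesis using c(1,2) rn_pos[OF x, of h]
    by (auto simp: ennreal_mult_less_top)
qed

lemma orbit_integral_pos:
  assumes x: "x \<in> space M"
  shows "orbit_integral L act rn f x > 0"
proof (rule ccontr)
  assume "\<not> orbit_integral L act rn f x > 0"
  then have "(\<integral>\<^sup>+ g. ennreal (rn g x * f (act g x)) \<partial>L) = 0" by (simp add: orbit_integral_def)
  then have "AE g in L. ennreal (rn g x * f (act g x)) = 0"
    using x by (subst (asm) nn_integral_0_iff_AE) measurable
  then obtain g where "ennreal (rn g x * f (act g x)) = 0" using AE_haar_Ex by blast
  moreover have "rn g x * f (act g x) > 0" using x by (intro mult_pos_pos rn_pos f_pos act_space)
  ultimately show False by (metis ennreal_eq_0_iff not_le)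
qed

text \<open>
  The density of $p_x$, restricted to $\{g : g.x \in U\}$. For $S_f(x) = \infty$ it is zero by the
  conventions for conversion and division of real numbers.
\<close>

definition orbit_density :: "'x set \<Rightarrow> 'x \<Rightarrow> 'g \<Rightarrow> ennreal" where
  "orbit_density U x g =
     indicator U (act g x) * ennreal (rn g x * f (act g x) / enn2real (orbit_integral L act rn f x))"

definition orbit_measure :: "'x set \<Rightarrow> 'x \<Rightarrow> 'g measure" where
  "orbit_measure U x = density L (orbit_density U x)"

lemma orbit_density_measurable [measurable (raw)]:
  assumes [measurable]: "U \<in> sets M" "k \<in> borel_measurable N" "r \<in> N \<rightarrow>\<^sub>M M"
  shows "(\<lambda>z. orbit_density U (r z) (k z)) \<in> borel_measurable N"
  unfolding orbit_density_def by measurable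

lemma nn_integral_orbit_measure:
  assumes [measurable]: "U \<in> sets M" "\<psi> \<in> borel_measurable borel" and x: "x \<in> space M"
  shows "(\<integral>\<^sup>+ g. \<psi> g \<partial>orbit_measure U x) = (\<integral>\<^sup>+ g. orbit_density U x g * \<psi> g \<partial>L)"
  unfolding orbit_measure_def using x by (intro nn_integral_density) measurable

text \<open>
  The factors $1/\nabla_h(x)$ of the integrand and of $S_f(h.x)$ cancel, and the modular factor of $S_f(h.x)$
  is the one that the substitution $g \mapsto gh^{-1}$ produces.
\<close>

lemma orbit_measure_translate:
  assumes [measurable]: "U \<in> sets M" "\<psi> \<in> borel_measurable borel" and x: "x \<in> space M"
  shows "(\<integral>\<^sup>+ g. \<psi> g \<partial>orbit_measure U (act h x)) = (\<integral>\<^sup>+ g. \<psi> (g - h) \<partial>orbit_measure U x)"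
proof -
  obtain c where c: "0 < c" "c < \<infinity>"
      "\<And>F. F \<in> borel_measurable borel \<Longrightarrow> (\<integral>\<^sup>+ g. F (g + h) \<partial>L) = c * (\<integral>\<^sup>+ g. F g \<partial>L)"
    using nn_integral_right_translate by metis
  obtain r where r: "c = ennreal r" "r > 0"
    using c(1,2) by (cases c) (auto simp: ennreal_less_zero_iff)
  have pos: "0 < rn h x" using x by (rule rn_pos)
  have S: "enn2real (orbit_integral L act rn f (act h x)) = 1 / rn h x * (r * enn2real (orbit_integral L act rn f x))"
  proof -
    have "orbit_integral L act rn f (act h x) = ennreal (1 / rn h x) * (c * orbit_integral L act rn f x)"
      by (rule orbit_integral_act[OF x c(1,2)]) (rule c(3))
    then show ?thesis using r pos by (simp add: enn2real_mult)
  qed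
  have dens: "orbit_density U (act h x) g = ennreal (1 / r) * orbit_density U x (g + h)" for g
  proof -
    have "rn g (act h x) = rn (g + h) x / rn h x" using rn_add[OF x, of g h] pos by simp
    then have "rn g (act h x) * f (act g (act h x)) / (1 / rn h x * (r * enn2real (orbit_integral L act rn f x))) =
      1 / r * (rn (g + h) x * f (act (g + h) x) / enn2real (orbit_integral L act rn f x))"
      using pos r(2) by (simp add: act_add[OF x])
    then have "orbit_density U (act h x) g = indicator U (act g (act h x)) *
        ennreal (1 / r * (rn (g + h) x * f (act (g + h) x) / enn2real (orbit_integral L act rn f x)))"
      unfolding orbit_density_def S by metis
    also have "\<dots> = ennreal (1 / r) * orbit_density U x (g + h)"
      unfolding orbit_density_def using r(2)
      by (subst ennreal_mult') (auto simp: act_add[OF x] mult.left_commute)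
    finally show ?thesis .
  qed
  have "(\<integral>\<^sup>+ g. \<psi> g \<partial>orbit_measure U (act h x)) = (\<integral>\<^sup>+ g. ennreal (1 / r) * (orbit_density U x (g + h) * \<psi> (g + h - h)) \<partial>L)"
    by (subst nn_integral_orbit_measure) (auto simp: act_space x dens mult.assoc)
  also have "\<dots> = ennreal (1 / r) * (\<integral>\<^sup>+ g. orbit_density U x (g + h) * \<psi> (g + h - h) \<partial>L)"
    using x by (intro nn_integral_cmult) measurable
  also have "(\<integral>\<^sup>+ g. orbit_density U x (g + h) * \<psi> (g + h - h) \<partial>L) = c * (\<integral>\<^sup>+ g. orbit_density U x g * \<psi> (g - h) \<partial>L)"
    using x by (intro c(3)) measurable
  also have "ennreal (1 / r) * (c * (\<integral>\<^sup>+ g. orbit_density U x g * \<psi> (g - h) \<partial>L)) = (\<integral>\<^sup>+ g. orbit_density U x g * \<psi> (g - h) \<partial>L)"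
    using r by (simp add: mult.assoc[symmetric] ennreal_mult'[symmetric])
  also have "\<dots> = (\<integral>\<^sup>+ g. \<psi> (g - h) \<partial>orbit_measure U x)"
    using x by (intro nn_integral_orbit_measure[symmetric]) measurable
  finally show ?thesis .
qed

lemma orbit_measure_finite:
  assumes U [measurable]: "U \<in> sets M" and x: "x \<in> space M" and fin: "orbit_integral L act rn f x < \<infinity>"
  shows "finite_measure (orbit_measure U x)"
proof
  let ?S = "orbit_integral L act rn f x"
  have "emeasure (orbit_measure U x) (space (orbit_measure U x)) = (\<integral>\<^sup>+ g. orbit_density U x g \<partial>L)"
    unfolding orbit_measure_def using x by (subst emeasure_density) (auto intro!: nn_integral_cong)
  also have "\<dots> \<le> (\<integral>\<^sup>+ g. ennreal (1 / enn2real ?S) * ennreal (rn g x * f (act g x)) \<partial>L)"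
  proof (rule nn_integral_mono)
    fix g
    have "ennreal (1 / enn2real ?S) * ennreal (rn g x * f (act g x)) = ennreal (rn g x * f (act g x) / enn2real ?S)"
      by (subst ennreal_mult'[symmetric]) auto
    then show "orbit_density U x g \<le> ennreal (1 / enn2real ?S) * ennreal (rn g x * f (act g x))"
      by (auto simp: orbit_density_def indicator_def)
  qed
  also have "\<dots> = ennreal (1 / enn2real ?S) * ?S"
    unfolding orbit_integral_def using x by (intro nn_integral_cmult) measurable
  also have "\<dots> < \<infinity>" using fin by (simp add: ennreal_mult_less_top)
  finally show "emeasure (orbit_measure U x) (space (orbit_measure U x)) \<noteq> \<infinity>" by simp
qed

lemma sets_orbit_measure [simp]: "sets (orbit_measure U x) = sets borel"
  by (simp add: orbit_measure_def)

lemma orbit_density_pos: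
  assumes x: "x \<in> space M" and fin: "orbit_integral L act rn f x < \<infinity>"
  shows "orbit_density (space M) x g > 0"
proof -
  have "0 < rn g x * f (act g x) / enn2real (orbit_integral L act rn f x)"
    using x fin orbit_integral_pos[OF x]
    by (intro divide_pos_pos mult_pos_pos rn_pos f_pos act_space) (auto simp: enn2real_positive_iff)
  then show ?thesis using x by (simp add: orbit_density_def act_space)
qed

text \<open>
  The transversal consists of the points whose coordinates are lexicographically greatest in their orbit.
\<close>

lemma dissipative_part_smooth:
  assumes "X' = {x\<in>space M. orbit_integral L act rn f x < \<infinity>}"
  shows "\<exists>W\<in>sets M. W \<subseteq> X' \<and> (\<forall>x\<in>X'. \<exists>g. act g x \<in> W) \<and>
           (\<forall>x\<in>W. \<forall>g. act g x \<in> W \<longrightarrow> act g x = x)"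
    and "x \<in> X' \<Longrightarrow> compact (stabilizer act x)"
proof -
  have X'_sets [measurable]: "X' \<in> sets M" unfolding assms by measurable
  have X'_space: "x \<in> space M" and X'_fin: "orbit_integral L act rn f x < \<infinity>" if "x \<in> X'" for x
    using that assms by auto
  have X'_act: "act g x \<in> X'" if "x \<in> X'" for g x
    using that unfolding assms by (simp add: act_space orbit_integral_act_finite_iff[unfolded infinity_ennreal_def])
  obtain u :: "nat \<Rightarrow> 'g \<Rightarrow> real"
    where u: "\<And>i. continuous_on UNIV (u i)" "\<And>i g. 0 \<le> u i g" "\<And>i g. u i g \<le> 1"
      and u_supp: "\<And>i. \<exists>C. compact C \<and> (\<forall>g. g \<notin> C \<longrightarrow> u i g = 0)" and u0: "\<exists>g. u 0 g > 0"
      and u_det: "\<And>q q'. finite_measure q \<Longrightarrow> finite_measure q' \<Longrightarrow> sets q = sets borel \<Longrightarrow> sets q' = sets borel \<Longrightarrow>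
       (\<And>i. (\<integral>\<^sup>+ g. ennreal (u i g) \<partial>q) = (\<integral>\<^sup>+ g. ennreal (u i g) \<partial>q')) \<Longrightarrow> q = q'"
    by (rule measure_determining_functions) blast
  obtain U :: "nat \<Rightarrow> 'x set" where U: "\<And>n. U n \<in> sets M" "U 0 = space M"
    "\<And>x y. x \<in> space M \<Longrightarrow> y \<in> space M \<Longrightarrow> (\<And>n. x \<in> U n \<longleftrightarrow> y \<in> U n) \<Longrightarrow> x = y"
    by (rule separating_sets) blast
  have [measurable]: "u i \<in> borel_measurable borel" for i by (intro borel_measurable_continuous_onI u)
  note [measurable] = U(1)
  (* The coordinates: integrals of the i-th test function against the orbit measure restricted by the
     n-th separating set. *)
  define \<Phi>' where "\<Phi>' i n x = (\<integral>\<^sup>+ g. orbit_density (U n) x g * ennreal (u i g) \<partial>L)" for i n x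
  define \<Phi> where "\<Phi> j x = enn2real (\<Phi>' (fst (prod_decode j)) (snd (prod_decode j)) x)" for j x
  have [measurable]: "\<Phi> j \<in> borel_measurable M" for j unfolding \<Phi>_def \<Phi>'_def by measurable
  have \<Phi>': "\<Phi>' i n x = (\<integral>\<^sup>+ g. ennreal (u i g) \<partial>orbit_measure (U n) x)" if "x \<in> X'" for i n x
    unfolding \<Phi>'_def using X'_space[OF that] by (intro nn_integral_orbit_measure[symmetric]) measurable
  have fm: "finite_measure (orbit_measure (U n) x)" if "x \<in> X'" for n x
    using that by (intro orbit_measure_finite X'_space X'_fin U)
  have \<Phi>'_fin: "\<Phi>' i n x < \<infinity>" if x: "x \<in> X'" for i n x
  proof -
    interpret q: finite_measure "orbit_measure (U n) x" by (rule fm[OF x])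
    have "\<Phi>' i n x \<le> (\<integral>\<^sup>+ g. 1 \<partial>orbit_measure (U n) x)"
      unfolding \<Phi>'[OF x] using u(3) by (intro nn_integral_mono) simp
    also have "\<dots> < \<infinity>" using q.emeasure_finite by (simp add: less_top[symmetric])
    finally show ?thesis .
  qed
  have \<Phi>_act: "\<Phi> j (act h x) =
      (\<integral>g. u (fst (prod_decode j)) (g - h) \<partial>orbit_measure (U (snd (prod_decode j))) x)"
    if x: "x \<in> X'" for j h x
  proof -
    have "\<Phi> j (act h x) = enn2real (\<integral>\<^sup>+ g. ennreal (u (fst (prod_decode j)) (g - h)) \<partial>orbit_measure (U (snd (prod_decode j))) x)"
      unfolding \<Phi>_def \<Phi>'[OF X'_act[OF x]] using X'_space[OF x] by (subst orbit_measure_translate) auto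
    also have "\<dots> = (\<integral>g. u (fst (prod_decode j)) (g - h) \<partial>orbit_measure (U (snd (prod_decode j))) x)"
      using u(2) by (intro integral_eq_nn_integral[symmetric]) (auto simp: measurable_cong_sets[OF sets_orbit_measure refl])
    finally show ?thesis .
  qed
  (* Equal coordinates give equal restricted orbit measures and hence densities that agree almost
     everywhere. At a common group element g, the density being positive, g.x and g.y lie in the same
     separating sets. *)
  have \<Phi>_inj: "x = y" if x: "x \<in> X'" and y: "y \<in> X'" and eq: "\<And>j. \<Phi> j x = \<Phi> j y" for x y
  proof -
    have "\<Phi>' i n x = \<Phi>' i n y" for i n
    proof -
      have "enn2real (\<Phi>' i n x) = enn2real (\<Phi>' i n y)"
        using eq[of "prod_encode (i, n)"] by (simp add: \<Phi>_def)
      then show ?thesis using \<Phi>'_fin[OF x, of i n] \<Phi>'_fin[OF y, of i n] by (metis ennreal_enn2real infinity_ennreal_def)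
    qed
    then have "orbit_measure (U n) x = orbit_measure (U n) y" for n
      using fm[OF x] fm[OF y] by (intro u_det) (simp_all add: \<Phi>'[OF x] \<Phi>'[OF y])
    then have "AE g in L. orbit_density (U n) x g = orbit_density (U n) y g" for n
      unfolding orbit_measure_def using X'_space[OF x] X'_space[OF y]
      by (subst (asm) density_unique_iff) measurable
    then have "AE g in L. \<forall>n. orbit_density (U n) x g = orbit_density (U n) y g" by (simp add: AE_all_countable)
    then obtain g where g: "\<And>n. orbit_density (U n) x g = orbit_density (U n) y g" using AE_haar_Ex by blast
    have dens: "orbit_density (U n) z g = indicator (U n) (act g z) * orbit_density (space M) z g" if "z \<in> X'" for z n
      using X'_space[OF that] by (simp add: orbit_density_def act_space)
    have "orbit_density (space M) x g = orbit_density (space M) y g" using g[of 0] U(2) by simp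
    moreover have "orbit_density (space M) x g > 0" by (intro orbit_density_pos X'_space X'_fin x)
    ultimately have "act g x \<in> U n \<longleftrightarrow> act g y \<in> U n" for n
      using g[of n] unfolding dens[OF x] dens[OF y]
      by (cases "act g x \<in> U n"; cases "act g y \<in> U n") auto
    then have "act g x = act g y"
      by (intro U(3) act_space X'_space x y)
    then show ?thesis using act_minus(1)[OF X'_space[OF x], of g] act_minus(1)[OF X'_space[OF y], of g] by metis
  qed
  (* The coordinates along the orbit, as functions of the group element. *)
  define F where "F x j h = \<Phi> j (act h x)" for x j h
  have F_cont: "continuous_on UNIV (F x j)" if x: "x \<in> X'" for x j
    unfolding F_def \<Phi>_act[OF x] by (rule translate_integral_continuous[OF fm[OF x] sets_orbit_measure u])
  have F_vanish: "\<exists>C. compact C \<and> (\<forall>h. h \<notin> C \<longrightarrow> F x 0 h < e)" if x: "x \<in> X'" and e: "e > 0" for x e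
  proof -
    obtain C where C: "compact C" "\<And>g. g \<notin> C \<Longrightarrow> u (fst (prod_decode 0)) g = 0" using u_supp by metis
    show ?thesis
      unfolding F_def \<Phi>_act[OF x]
      by (rule translate_integral_vanishes[OF fm[OF x] sets_orbit_measure u C(1) _ e]) (rule C(2))
  qed
  (* The pair with code 0 is (0, 0): a nonzero test function and the whole space. *)
  have \<Phi>_pos: "\<Phi> 0 x > 0" if x: "x \<in> X'" for x
  proof -
    have "\<Phi>' 0 0 x \<noteq> 0"
    proof
      assume "\<Phi>' 0 0 x = 0"
      then have "AE g in L. orbit_density (U 0) x g * ennreal (u 0 g) = 0"
        unfolding \<Phi>'_def using X'_space[OF x] by (subst (asm) nn_integral_0_iff_AE) measurable
      then have "AE g in L. \<not> 0 < u 0 g"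
        by (rule AE_mp) (use orbit_density_pos[OF X'_space[OF x] X'_fin[OF x]] in \<open>auto simp: U(2) ennreal_eq_0_iff less_le\<close>)
      moreover have "open {g. 0 < u 0 g}" by (intro open_Collect_less continuous_intros u)
      ultimately have "emeasure L {g. 0 < u 0 g} = 0"
        by (subst (asm) AE_iff_measurable[where N = "{g. 0 < u 0 g}"]) auto
      then show False using open_positive[OF \<open>open {g. 0 < u 0 g}\<close>] u0 by auto
    qed
    then show ?thesis using \<Phi>'_fin[OF x, of 0 0]
      by (simp add: \<Phi>_def enn2real_positive_iff prod_decode_def prod_decode_aux.simps zero_less_iff_neq_zero)
  qed
  have F0: "F x j 0 = \<Phi> j x" if "x \<in> X'" for x j unfolding F_def using X'_space[OF that] by (simp add: act_zero)
  have F_act: "F (act h x) = (\<lambda>j k. F x j (k + h))" if "x \<in> X'" for h x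
    unfolding F_def using X'_space[OF that] by (simp add: act_add)
  (* Moving the base point along the orbit is a right translation in the group. *)
  have lex_act: "lex_maximal (F (act h x)) 0 \<longleftrightarrow> lex_maximal (F x) h" if x: "x \<in> X'" for h x
  proof -
    have "(\<forall>k. P (k + h)) \<longleftrightarrow> (\<forall>k. P k)" for P :: "'g \<Rightarrow> bool"
      by (metis diff_add_cancel)
    from this[of "\<lambda>k. (\<forall>i<_. F x i k > F x i h - _) \<longrightarrow> F x _ k \<le> F x _ h + _"]
    show ?thesis unfolding lex_maximal_def F_act[OF x] by simp
  qed
  define W where "W = {x\<in>X'. lex_maximal (F x) 0}"
  have "W \<in> sets M"
  proof -
    obtain D :: "'g set" where D: "countable D" "\<And>V. open V \<Longrightarrow> V \<noteq> {} \<Longrightarrow> \<exists>d\<in>D. d \<in> V"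
      using countable_dense_exists by blast
    have "D \<noteq> {}" using D(2)[of UNIV] by auto
    define d where "d = from_nat_into D"
    have d: "range d = D" unfolding d_def using D(1) \<open>D \<noteq> {}\<close> by (intro range_from_nat_into)
    have "W = {x\<in>space M. x \<in> X' \<and> (\<forall>j n. \<exists>m. \<forall>k. (\<forall>i<j. \<Phi> i (act (d k) x) > \<Phi> i x - 1 / real (Suc m)) \<longrightarrow>
        \<Phi> j (act (d k) x) \<le> \<Phi> j x + 1 / real (Suc n))}"
    proof -
      have "lex_maximal (F x) 0 \<longleftrightarrow> (\<forall>j n. \<exists>m. \<forall>k. (\<forall>i<j. \<Phi> i (act (d k) x) > \<Phi> i x - 1 / real (Suc m)) \<longrightarrow>
        \<Phi> j (act (d k) x) \<le> \<Phi> j x + 1 / real (Suc n))" if x: "x \<in> X'" for x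
      proof -
        have "lex_maximal (F x) 0 \<longleftrightarrow> (\<forall>j n. \<exists>m. \<forall>k\<in>range d. (\<forall>i<j. F x i k > F x i 0 - 1 / real (Suc m)) \<longrightarrow>
            F x j k \<le> F x j 0 + 1 / real (Suc n))"
          unfolding d by (rule lex_maximal_dense[OF F_cont[OF x] D(2)])
        then show ?thesis unfolding F0[OF x] by (simp add: F_def)
      qed
      then show ?thesis unfolding W_def using X'_space by blast
    qed
    also have "\<dots> \<in> sets M" by measurable
    finally show ?thesis .
  qed
  moreover have "\<exists>g. act g x \<in> W" if x: "x \<in> X'" for x
  proof -
    have "0 < F x 0 0" using F0[OF x] \<Phi>_pos[OF x] by simp
    with F_cont[OF x] F_vanish[OF x] have "\<exists>h. lex_maximal (F x) h" by (rule lex_maximal_exists)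
    then obtain h where "lex_maximal (F x) h" ..
    then show ?thesis using lex_act[OF x] X'_act[OF x] unfolding W_def by blast
  qed
  moreover have "act g x = x" if "x \<in> W" "act g x \<in> W" for x g
  proof -
    have x: "x \<in> X'" and "lex_maximal (F x) 0" "lex_maximal (F x) g"
      using that lex_act[of x g] by (auto simp: W_def)
    then have "F x j g = F x j 0" for j by (intro lex_maximal_value_unique)
    then have "\<Phi> j (act g x) = \<Phi> j x" for j using F0[OF x] by (simp add: F_def)
    then show ?thesis using \<Phi>_inj[OF X'_act[OF x] x] by blast
  qed
  moreover have "W \<subseteq> X'" by (auto simp: W_def)
  ultimately show "\<exists>W\<in>sets M. W \<subseteq> X' \<and> (\<forall>x\<in>X'. \<exists>g. act g x \<in> W) \<and>
           (\<forall>x\<in>W. \<forall>g. act g x \<in> W \<longrightarrow> act g x = x)" by blast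
  show "compact (stabilizer act x)" if x: "x \<in> X'"
  proof -
    have stab: "stabilizer act x = (\<Inter>j. {g. F x j g = F x j 0})"
    proof (intro set_eqI iffI)
      fix g assume "g \<in> (\<Inter>j. {g. F x j g = F x j 0})"
      then have "\<Phi> j (act g x) = \<Phi> j x" for j using F0[OF x] by (auto simp: F_def)
      then show "g \<in> stabilizer act x" using \<Phi>_inj[OF X'_act[OF x] x] by (simp add: stabilizer_def)
    qed (use X'_space[OF x] in \<open>auto simp: stabilizer_def F_def act_zero\<close>)
    have "closed (stabilizer act x)"
      unfolding stab by (intro closed_INT ballI closed_Collect_eq continuous_intros F_cont x)
    obtain C where C: "compact C" "\<And>h. h \<notin> C \<Longrightarrow> F x 0 h < \<Phi> 0 x" using F_vanish[OF x \<Phi>_pos[OF x]] by blast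
    have "stabilizer act x \<subseteq> C"
    proof
      fix g assume "g \<in> stabilizer act x"
      then have "F x 0 g = \<Phi> 0 x" by (simp add: stabilizer_def F_def)
      then show "g \<in> C" using C(2)[of g] by fastforce
    qed
    then have "stabilizer act x = C \<inter> stabilizer act x" by blast
    then show ?thesis using compact_Int_closed[OF C(1) \<open>closed (stabilizer act x)\<close>] by simp
  qed
qed

end
end

section \<open>The equivalence\<close>

theorem theoremC:
  fixes L :: "'g::{topological_group_add, second_countable_topology, t2_space} measure"
    and act :: "'g \<Rightarrow> 'x \<Rightarrow> 'x"
    and M :: "'x measure"
    and rn :: "'g \<Rightarrow> 'x \<Rightarrow> real"
  assumes "locally_compact_space (euclidean :: 'g topology)"
    and "left_haar_measure L"
    and "nonsingular_G_space act M"
    and "radon_nikodym_cocycle act M rn"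
  shows "totally_dissipative L act M rn \<longleftrightarrow>
    (\<exists>X'\<in>sets M. G_invariant act X' \<and> space M - X' \<in> null_sets M \<and>
       smooth_relation (restrict_space M X') (orbit_equivalence_relation act X') \<and>
       (\<forall>x\<in>X'. compact (stabilizer act x)))"
proof
  interpret nonsingular_action L act M rn
    using assms by unfold_locales
  {
    assume "totally_dissipative L act M rn"
    then obtain C D where CD: "hopf_decomposition L act M rn C D" "emeasure M C = 0"
      unfolding totally_dissipative_def by blast
    obtain f :: "'x \<Rightarrow> real" where "f \<in> borel_measurable M" "\<And>x. f x > 0" "integrable M f"
      using M.obtain_positive_integrable_function by metis
    then have f: "f \<in> L1_plus M" by (simp add: L1_plus_def)
    note [measurable] = orbit_integral_measurable[OF f]
    define X' where "X' = {x\<in>space M. orbit_integral L act rn f x < \<infinity>}"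
    have X': "X' \<in> sets M" unfolding X'_def by measurable
    have inv: "act g x \<in> X'" if "x \<in> X'" for g x
      using that unfolding X'_def by (simp add: act_space orbit_integral_act_finite_iff[OF f, unfolded infinity_ennreal_def])
    obtain W where W: "W \<in> sets M" "W \<subseteq> X'" "\<And>x. x \<in> X' \<Longrightarrow> \<exists>g. act g x \<in> W"
      "\<And>x g. x \<in> W \<Longrightarrow> act g x \<in> W \<Longrightarrow> act g x = x"
      using dissipative_part_smooth(1)[OF f X'_def] by blast
    show "\<exists>X'\<in>sets M. G_invariant act X' \<and> space M - X' \<in> null_sets M \<and>
       smooth_relation (restrict_space M X') (orbit_equivalence_relation act X') \<and>
       (\<forall>x\<in>X'. compact (stabilizer act x))"
    proof (intro bexI[of _ X'] conjI ballI X')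
      show "G_invariant act X'" using inv by (intro G_invariantI) (auto simp: X'_def)
      have "AE x in M. x \<in> D \<longleftrightarrow> orbit_integral L act rn f x < \<infinity>" "C \<union> D = space M" "C \<in> sets M"
        using CD(1) f unfolding hopf_decomposition_def by blast+
      moreover from this have "AE x in M. x \<notin> C" using CD(2) by (intro AE_not_in) auto
      ultimately have "AE x in M. x \<in> X'" unfolding X'_def by auto
      then show "space M - X' \<in> null_sets M" using X' by (subst (asm) AE_iff_null) (auto simp: Diff_eq Int_def)
      show "smooth_relation (restrict_space M X') (orbit_equivalence_relation act X')"
        unfolding smooth_relation_def
      proof (intro bexI[of _ W] ballI)
        fix x assume "x \<in> space (restrict_space M X')"
        then have x: "x \<in> X'" "x \<in> space M" by (auto simp: space_restrict_space)
        have orb: "orbit_equivalence_relation act X' `` {x} = range (\<lambda>g. act g x)"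
          using x by (auto simp: orbit_equivalence_relation_def)
        obtain g where g: "act g x \<in> W" using W(3)[OF x(1)] by blast
        show "\<exists>!w. w \<in> W \<inter> orbit_equivalence_relation act X' `` {x}"
        proof (rule ex1I[of _ "act g x"])
          show "act g x \<in> W \<inter> orbit_equivalence_relation act X' `` {x}" using g orb by blast
          fix w assume "w \<in> W \<inter> orbit_equivalence_relation act X' `` {x}"
          then obtain h where w: "w \<in> W" "w = act h x" unfolding orb by blast
          have "act (h - g) (act g x) = w" using w x(2) by (simp add: act_add[symmetric])
          then show "w = act g x" using W(4)[OF g, of "h - g"] w(1) by simp
        qed
      next
        show "W \<in> sets (restrict_space M X')" using W X' by (simp add: sets_restrict_space_iff)
      qed
      show "compact (stabilizer act x)" if "x \<in> X'" for x using dissipative_part_smooth(2)[OF f X'_def that] .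
    qed
  }
  assume "\<exists>X'\<in>sets M. G_invariant act X' \<and> space M - X' \<in> null_sets M \<and>
       smooth_relation (restrict_space M X') (orbit_equivalence_relation act X') \<and>
       (\<forall>x\<in>X'. compact (stabilizer act x))"
  then obtain X' where X': "X' \<in> sets M" "space M - X' \<in> null_sets M" and inv: "G_invariant act X'"
    and smooth: "smooth_relation (restrict_space M X') (orbit_equivalence_relation act X')"
    and stab: "\<And>x. x \<in> X' \<Longrightarrow> compact (stabilizer act x)" by blast
  have X'_space: "X' \<subseteq> space M" using X'(1) by (rule sets.sets_into_space)
  have inv': "act g x \<in> X'" if "x \<in> X'" for g x using inv that by (auto simp: G_invariant_def)
  obtain W where W: "W \<in> sets (restrict_space M X')"
    and W_ex1: "\<And>x. x \<in> X' \<Longrightarrow> \<exists>!w. w \<in> W \<inter> orbit_equivalence_relation act X' `` {x}"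
    using smooth X'_space unfolding smooth_relation_def by (auto simp: space_restrict_space Int_absorb1 Int_absorb2)
  have W': "W \<in> sets M" "W \<subseteq> X'" using W X' by (auto simp: sets_restrict_space_iff)
  have orb: "w \<in> orbit_equivalence_relation act X' `` {x} \<longleftrightarrow> (\<exists>g. w = act g x)" if "x \<in> X'" for x w
    using that by (auto simp: orbit_equivalence_relation_def)
  have fin: "AE x in M. orbit_integral L act rn f x < \<infinity>" if f: "f \<in> L1_plus M" for f
  proof (rule orbit_integral_finite_of_transversal[OF f X' inv' W' _ _ stab])
    show "\<exists>g. act g x \<in> W" if x: "x \<in> X'" for x
    proof -
      obtain w where w: "w \<in> W \<inter> orbit_equivalence_relation act X' `` {x}" using W_ex1[OF x] by (rule ex1E)
      then obtain g where "w = act g x" using orb[OF x, of w] by auto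
      then show ?thesis using w by blast
    qed
    show "act g x = x" if "x \<in> W" "act g x \<in> W" for x g
    proof -
      have x: "x \<in> X'" using that W' by blast
      have "\<exists>h. x = act h x" using x X'_space by (intro exI[of _ 0]) (auto simp: act_zero)
      then have "x \<in> W \<inter> orbit_equivalence_relation act X' `` {x}" using orb[OF x, of x] that(1) by simp
      moreover have "act g x \<in> W \<inter> orbit_equivalence_relation act X' `` {x}"
        using orb[OF x, of "act g x"] that(2) by auto
      ultimately show ?thesis using W_ex1[OF x] by (metis (no_types, lifting))
    qed
  qed
  have "hopf_decomposition L act M rn {} (space M)"
    unfolding hopf_decomposition_def
  proof (intro conjI ballI)
    show "G_invariant act {}" by (simp add: G_invariant_def)
    show "G_invariant act (space M)" by (intro G_invariantI) (auto intro: act_space)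
    fix f assume "f \<in> L1_plus M"
    note fin[OF this]
    then show "AE x in M. x \<in> {} \<longleftrightarrow> orbit_integral L act rn f x = \<infinity>"
      "AE x in M. x \<in> space M \<longleftrightarrow> orbit_integral L act rn f x < \<infinity>" by auto
  qed auto
  then show "totally_dissipative L act M rn" unfolding totally_dissipative_def by fastforce
qed

end
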